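(* Let $d=2$ or $d=3$, and let $\rho>0$. If $E_{\rm min}(\rho)<0$, then \[ m_p:=\inf\{\|\phi\|_{L^p(\mathbb{R}^d)} \,:\, \phi\in\mathcal{E}(\rho)\}>0 \] for every $p\in(4,\infty]$. In particular, there exists $\varepsilon_0=\varepsilon_0(d)>0$, depending only on $d$, such that for every $0<\varepsilon\le\varepsilon_0(d)$, any solution $u$ provided by the definition of $\mathcal{E}(\rho)$-orbital stability with parameter $\varepsilon$ satisfies \[ \inf_{t\in\mathbb{R}}\|u(t,\cdot)\|_{L^\infty(\mathbb{R}^d)}>0 . \] Here "a solution provided by the definition of $\mathcal{E}(\rho)$-orbital stability with parameter $\varepsilon$" means: the solution $u$ of the cubic-quintic NLS with $u_{|t=0}=u_0\in H^1(\mathbb{R}^d)$, where $\inf_{\phi\in\mathcal{E}(\rho)}\|u_0-\phi\|_{H^1(\mathbb{R}^d)}\le\delta$ and $\delta>0$ is a number associated with $\varepsilon$ as in that definition (so that $\sup_{t\in\mathbb{R}}\inf_{\phi\in\mathcal{E}(\rho)}\|u(t,\cdot)-\phi\|_{H^1(\mathbb{R}^d)}\le\varepsilon$).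
   Context: Functions are complex-valued. The cubic-quintic NLS on $\mathbb{R}^d$ is \[ i\partial_t u+\tfrac12\Delta u=-|u|^2u+|u|^4u,\qquad (t,x)\in\mathbb{R}\times\mathbb{R}^d . \] For $d=2,3$ and every $u_0\in H^1(\mathbb{R}^d)$ it is known to have a unique solution $u\in C(\mathbb{R};H^1(\mathbb{R}^d))$ with $u_{|t=0}=u_0$, and this solution conserves mass and energy. Mass: $M(u)=\|u\|_{L^2(\mathbb{R}^d)}^2$. Energy: $E(u)=\frac12\|\nabla u\|_{L^2(\mathbb{R}^d)}^2-\frac12\|u\|_{L^4(\mathbb{R}^d)}^4+\frac13\|u\|_{L^6(\mathbb{R}^d)}^6$. For $\rho>0$: \[ \Gamma(\rho)=\{u\in H^1(\mathbb{R}^d): M(u)=\rho\},\qquad E_{\rm min}(\rho)=\inf\{E(v): v\in\Gamma(\rho)\}, \] \[ \mathcal{E}(\rho)=\{u\in H^1(\mathbb{R}^d): M(u)=\rho,\ E(u)=E_{\rm min}(\rho)\} \] (the set of energy ground states of mass $\rho$). Definition ($\mathcal{E}(\rho)$-orbital stability). Solitary waves are $\mathcal{E}(\rho)$-orbitally stable if for all $\varepsilon>0$ there exists $\delta>0$ such that if $u_0\in H^1(\mathbb{R}^d)$ satisfies $\inf_{\phi\in\mathcal{E}(\rho)}\|u_0-\phi\|_{H^1(\mathbb{R}^d)}\le\delta$, then the solution $u$ of the cubic-quintic NLS with $u_{|t=0}=u_0$ satisfies $\sup_{t\in\mathbb{R}}\inf_{\phi\in\mathcal{E}(\rho)}\|u(t,\cdot)-\phi\|_{H^1(\mathbb{R}^d)}\le\varepsilon$.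 It is known (earlier work) that if $E_{\rm min}(\rho)<0$ and $d\in\{2,3\}$, then $\mathcal{E}(\rho)\neq\emptyset$ and $\mathcal{E}(\rho)$-orbital stability holds. *)

theory Defs
  imports "HOL-Analysis.Analysis" "HOL-Probability.Essential_Supremum"
begin

text \<open>
  Elements of $L^p$ and $H^1$ are represented by Borel functions on \<open>real ^ 'd\<close>. Every
  almost-everywhere class of Lebesgue measurable functions has such a representative, and all
  notions below are invariant under changes on null sets.
\<close>

subsection \<open>Lebesgue norms\<close>

text \<open>The value \<open>\<infinity>\<close> means that the function is not in $L^p$.\<close>

definition Lp_norm :: "ennreal \<Rightarrow> ('a::euclidean_space \<Rightarrow> 'b::real_normed_vector) \<Rightarrow> ennreal" where
  "Lp_norm p f =
    (if p = \<infinity> then esssup lborel (\<lambda>x. ennreal (norm (f x)))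
     else let I = (\<integral>\<^sup>+x. ennreal (norm (f x) powr enn2real p) \<partial>lborel)
          in if I = \<infinity> then \<infinity> else ennreal (enn2real I powr (1 / enn2real p)))"

definition L2 :: "('a::euclidean_space \<Rightarrow> 'b::real_normed_vector) set" where
  "L2 = {f \<in> borel_measurable lborel. Lp_norm 2 f < \<infinity>}"

subsection \<open>Test functions and the Sobolev space $H^1$\<close>

definition partial_deriv ::
    "'a::euclidean_space \<Rightarrow> ('a \<Rightarrow> 'b::real_normed_vector) \<Rightarrow> 'a \<Rightarrow> 'b" where
  "partial_deriv b f = (\<lambda>x. frechet_derivative f (at x) b)"

primrec Ck :: "nat \<Rightarrow> ('a::euclidean_space \<Rightarrow> 'b::real_normed_vector) \<Rightarrow> bool" where
  "Ck 0 f \<longleftrightarrow> continuous_on UNIV f"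
| "Ck (Suc k) f \<longleftrightarrow> f differentiable_on UNIV \<and> (\<forall>b\<in>Basis. Ck k (partial_deriv b f))"

definition test_functions :: "('a::euclidean_space \<Rightarrow> complex) set" where
  "test_functions = {\<psi>. (\<forall>k. Ck k \<psi>) \<and> compact (closure {x. \<psi> x \<noteq> 0})}"

definition is_weak_gradient :: "(real ^ 'd \<Rightarrow> complex) \<Rightarrow> (real ^ 'd \<Rightarrow> complex ^ 'd) \<Rightarrow> bool" where
  "is_weak_gradient u G \<longleftrightarrow>
    (\<forall>\<psi>\<in>test_functions. \<forall>i.
       (\<integral>x. u x * partial_deriv (axis i 1) \<psi> x \<partial>lborel) = - (\<integral>x. G x $ i * \<psi> x \<partial>lborel))"

definition H1 :: "(real ^ 'd \<Rightarrow> complex) set" where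
  "H1 = {u \<in> L2. \<exists>G\<in>L2. is_weak_gradient u G}"

text \<open>The gradient of a function in \<open>H1\<close>; it is unique up to null sets.\<close>

definition weak_gradient :: "(real ^ 'd \<Rightarrow> complex) \<Rightarrow> real ^ 'd \<Rightarrow> complex ^ 'd" where
  "weak_gradient u = (SOME G. G \<in> L2 \<and> is_weak_gradient u G)"

definition H1_norm :: "(real ^ 'd \<Rightarrow> complex) \<Rightarrow> real" where
  "H1_norm u = sqrt ((enn2real (Lp_norm 2 u))\<^sup>2 + (enn2real (Lp_norm 2 (weak_gradient u)))\<^sup>2)"

subsection \<open>Mass, energy and ground states\<close>

definition mass :: "(real ^ 'd \<Rightarrow> complex) \<Rightarrow> real" where
  "mass u = (enn2real (Lp_norm 2 u))\<^sup>2"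

text \<open>In dimensions 2 and 3 all norms in the energy are finite on \<open>H1\<close>, by Sobolev embedding.\<close>

definition energy :: "(real ^ 'd \<Rightarrow> complex) \<Rightarrow> real" where
  "energy u = 1/2 * (enn2real (Lp_norm 2 (weak_gradient u)))\<^sup>2
            - 1/2 * (enn2real (Lp_norm 4 u)) ^ 4
            + 1/3 * (enn2real (Lp_norm 6 u)) ^ 6"

definition mass_sphere :: "real \<Rightarrow> (real ^ 'd \<Rightarrow> complex) set" where
  "mass_sphere \<rho> = {u \<in> H1. mass u = \<rho>}"

text \<open>
  The infimum is taken over a nonempty set which is bounded below, since
  $\frac12 s^4 - \frac13 s^6 \le \frac{3}{16} s^2$. The type argument carries the dimension.
\<close>

definition E_min :: "'d::finite itself \<Rightarrow> real \<Rightarrow> real" where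
  "E_min _ \<rho> = (INF v \<in> (mass_sphere \<rho> :: (real ^ 'd \<Rightarrow> complex) set). energy v)"

definition ground_states :: "real \<Rightarrow> (real ^ 'd \<Rightarrow> complex) set" where
  "ground_states \<rho> = {u \<in> H1. mass u = \<rho> \<and> energy u = E_min TYPE('d) \<rho>}"

definition dist_ground_states :: "real \<Rightarrow> (real ^ 'd \<Rightarrow> complex) \<Rightarrow> ennreal" where
  "dist_ground_states \<rho> u = (INF \<phi>\<in>ground_states \<rho>. ennreal (H1_norm (\<lambda>x. u x - \<phi> x)))"

subsection \<open>The cubic-quintic equation and orbital stability\<close>

definition nonlinearity :: "complex \<Rightarrow> complex" where
  "nonlinearity z = - of_real ((cmod z)\<^sup>2) * z + of_real ((cmod z) ^ 4) * z"

definition time_deriv :: "(real \<times> (real ^ 'd) \<Rightarrow> complex) \<Rightarrow> real \<times> (real ^ 'd) \<Rightarrow> complex" where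
  "time_deriv \<psi> = partial_deriv (1, 0) \<psi>"

definition space_laplacian :: "(real \<times> (real ^ 'd) \<Rightarrow> complex) \<Rightarrow> real \<times> (real ^ 'd) \<Rightarrow> complex" where
  "space_laplacian \<psi> =
    (\<lambda>z. \<Sum>i\<in>UNIV. partial_deriv (0, axis i 1) (partial_deriv (0, axis i 1) \<psi>) z)"

text \<open>
  A global solution in $C(\mathbb{R};H^1)$; the equation holds in the sense of distributions on
  space-time. The integrals are iterated because the representatives \<open>u t\<close> may be chosen
  independently for different \<open>t\<close>, so that \<open>u\<close> need not be jointly measurable.
\<close>

definition NLS_solution :: "(real \<Rightarrow> real ^ 'd \<Rightarrow> complex) \<Rightarrow> bool" where
  "NLS_solution u \<longleftrightarrow>
    (\<forall>t. u t \<in> H1) \<and>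
    (\<forall>t. ((\<lambda>s. H1_norm (\<lambda>x. u s x - u t x)) \<longlongrightarrow> 0) (at t)) \<and>
    (\<forall>\<psi>\<in>test_functions.
       (\<integral>t. (\<integral>x. u t x * (- \<i> * time_deriv \<psi> (t, x) + 1/2 * space_laplacian \<psi> (t, x)) \<partial>lborel) \<partial>lborel)
       = (\<integral>t. (\<integral>x. nonlinearity (u t x) * \<psi> (t, x) \<partial>lborel) \<partial>lborel))"

definition NLS_solution_from ::
    "(real ^ 'd \<Rightarrow> complex) \<Rightarrow> (real \<Rightarrow> real ^ 'd \<Rightarrow> complex) \<Rightarrow> bool" where
  "NLS_solution_from u0 u \<longleftrightarrow> NLS_solution u \<and> (AE x in lborel. u 0 x = u0 x)"

text \<open>
  \<open>\<delta>\<close> is a number associated with \<open>\<epsilon>\<close> in the definition of orbital stability: solitary waves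
  are orbitally stable iff every \<open>\<epsilon> > 0\<close> admits such a \<open>\<delta>\<close>. The solution with
  given initial datum is unique up to the choice of representatives.
\<close>

definition stability_delta :: "'d::finite itself \<Rightarrow> real \<Rightarrow> real \<Rightarrow> real \<Rightarrow> bool" where
  "stability_delta _ \<rho> \<epsilon> \<delta> \<longleftrightarrow>
    \<delta> > 0 \<and>
    (\<forall>u0\<in>H1. \<forall>u :: real \<Rightarrow> real ^ 'd \<Rightarrow> complex.
       dist_ground_states \<rho> u0 \<le> ennreal \<delta> \<longrightarrow> NLS_solution_from u0 u \<longrightarrow>
       (SUP t. dist_ground_states \<rho> (u t)) \<le> ennreal \<epsilon>)"

end

theory Submission
  imports Defs
begin

text \<open>
  Let \<open>\<phi>\<close> be a ground state of mass \<open>\<rho>\<close> with $E(\phi) = E_{\rm min}(\rho) < 0$. Only the cubic term of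
  the energy is negative, so $\|\phi\|_4^4 \ge 2|E_{\rm min}(\rho)|$. For $p > 4$, splitting
  $\int|\phi|^4$ at a level \<open>l\<close> gives $\|\phi\|_4^4 \le l^2\rho + l^{4-p}\|\phi\|_p^p$, and a small \<open>l\<close>
  forces $\|\phi\|_p$ to stay away from zero (\<open>Lp_norm_lower_bound\<close>). This is the first claim.

  For the second claim, let \<open>v = u(t)\<close> and suppose $\|v\|_\infty \le \eta$ while
  $\|v - \phi\|_2 \le c$. No lower bound for $\|\phi\|_4$ is uniform in \<open>\<rho>\<close>: in dimension two
  it tends to zero at the threshold mass. The \<open>L\<^sup>2\<close> norm of the part of \<open>\<phi>\<close> above a low level is the
  quantity that cannot be small. Where $|\phi| > 2\eta$ one has $|\phi| \le 2|v - \phi|$, so that part has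
  \<open>L\<^sup>2\<close> norm at most \<open>2 c\<close>, and Sobolev inequalities bound its contribution to $\int|\phi|^4$:

  \<^item> if \<open>d = 2\<close>, by $C c^2\|\nabla\phi\|_2^2$ (\<open>moment4_dim2_le\<close>), where
    $\|\nabla\phi\|_2^2 \le \|\phi\|_4^4$ because the energy is negative;

  \<^item> if \<open>d = 3\<close>, by $2c\,\|\phi\|_6^3$, from $|\phi|^4 \le 2|v - \phi|\,|\phi|^3$
    (\<open>moment4_interpolation_le\<close>). Negative energy gives
    $\|\phi\|_6^6 \le \frac32\|\phi\|_4^4$, the Sobolev inequality (\<open>sobolev_dim3\<close>) gives
    $\|\phi\|_6^6 \le C\|\nabla\phi\|_2^6 \le C\|\phi\|_4^{12}$, and the geometric mean of the two is
    $\|\phi\|_6^6 \le C'\|\phi\|_4^8$, that is $\|\phi\|_6^3 \le C''\|\phi\|_4^4$.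

  In both cases the contribution is at most half of $\|\phi\|_4^4$ once \<open>c\<close> is smaller than a
  constant that depends only on \<open>d\<close>. What remains is $\|\phi\|_4^4 \le 136\,\eta^2\rho$
  (\<open>negative_energy_moment4_le\<close>), which contradicts $\|\phi\|_4^4 \ge 2|E_{\rm min}(\rho)|$ when
  \<open>\<eta>\<close> is small. Orbital stability provides, for each \<open>t\<close>, a ground state that close to \<open>u(t)\<close>.

  Both Sobolev inequalities come from one estimate for the measures $a(l)$ of the
  sets $\{|u| > l\}$, namely
  \[
  l^2\, a(2l) \le 2d\,(2a(l))^{2/d}\int_{l < |u| \le 2l}|\nabla u|^2
  \]
  (\<open>level_set_step\<close>). It is summed over dyadic levels, where the gradient integrals add
  up to at most $\|\nabla u\|_2^2$. To prove it, the weak gradient is turned into the a.e. identity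
  $u(x + sh) - u(x) = \int_0^s h\cdot\nabla u(x + th)\,dt$ (\<open>difference_eq_line_integral\<close>), by testing
  against smooth bumps that approximate indicators of boxes. Truncating \<open>|u|\<close> between \<open>l\<close> and
  \<open>2l\<close> and following the segments restricts the gradient to the band $l < |u| \le 2l$,
  and averaging over a cube gives the estimate.
\<close>

section \<open>Smooth bump functions\<close>

text \<open>
  Only the existence of successive derivatives is asserted, so that closure under sums and products
  is an induction on the order, without the Leibniz formula for higher derivatives.
\<close>

primrec times_diff :: "nat \<Rightarrow> (real \<Rightarrow> real) \<Rightarrow> bool" where
  "times_diff 0 q \<longleftrightarrow> continuous_on UNIV q"
| "times_diff (Suc k) q \<longleftrightarrow> (\<exists>q'. (\<forall>x. (q has_real_derivative q' x) (at x)) \<and> times_diff k q')"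

lemma times_diff_SucI:
  assumes "\<forall>x. (q has_real_derivative q' x) (at x)" "times_diff k q'"
  shows "times_diff (Suc k) q"
  unfolding times_diff.simps using assms by (intro exI[of _ q'] conjI)

lemma times_diff_continuous: "times_diff k q \<Longrightarrow> continuous_on UNIV q"
  by (cases k) (auto simp: continuous_on_eq_continuous_at dest: DERIV_isCont)

lemma times_diff_Suc: "times_diff (Suc k) q \<Longrightarrow> times_diff k q"
proof (induction k arbitrary: q)
  case 0
  then show ?case using times_diff_continuous[of "Suc 0" q] by simp
next
  case (Suc k)
  then obtain q' where "\<forall>x. (q has_real_derivative q' x) (at x)" "times_diff (Suc k) q'"
    unfolding times_diff.simps(2)[of "Suc k"] by blast
  with Suc.IH[of q'] show ?case by auto
qed

lemma times_diff_add: "times_diff k p \<Longrightarrow> times_diff k q \<Longrightarrow> times_diff k (\<lambda>x. p x + q x)"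
proof (induction k arbitrary: p q)
  case 0
  then show ?case by (auto intro: continuous_on_add)
next
  case (Suc k)
  then obtain p' q' where "\<forall>x. (p has_real_derivative p' x) (at x)" "times_diff k p'"
    "\<forall>x. (q has_real_derivative q' x) (at x)" "times_diff k q'" by auto
  then have "\<forall>x. ((\<lambda>x. p x + q x) has_real_derivative p' x + q' x) (at x)"
    "times_diff k (\<lambda>x. p' x + q' x)"
    using Suc.IH[of p' q'] DERIV_add by blast+
  then show ?case by (rule times_diff_SucI)
qed

lemma times_diff_mult: "times_diff k p \<Longrightarrow> times_diff k q \<Longrightarrow> times_diff k (\<lambda>x. p x * q x)"
proof (induction k arbitrary: p q)
  case 0
  then show ?case by (auto intro: continuous_on_mult)
next
  case (Suc k)
  then obtain p' q' where pq: "\<forall>x. (p has_real_derivative p' x) (at x)" "times_diff k p'"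
    "\<forall>x. (q has_real_derivative q' x) (at x)" "times_diff k q'" by auto
  have "times_diff k p" "times_diff k q"
    using Suc.prems times_diff_Suc by blast+
  then have "times_diff k (\<lambda>x. p' x * q x + q' x * p x)"
    using pq by (intro times_diff_add Suc.IH)
  moreover have "\<forall>x. ((\<lambda>x. p x * q x) has_real_derivative p' x * q x + q' x * p x) (at x)"
    using pq DERIV_mult by blast
  ultimately show ?case by (intro times_diff_SucI)
qed

lemma times_diff_const: "times_diff k (\<lambda>x. c)"
proof (induction k arbitrary: c)
  case (Suc k)
  have "\<forall>x. ((\<lambda>x. c) has_real_derivative 0) (at x)" by simp
  then show ?case by (rule times_diff_SucI) (rule Suc)
qed simp

lemma times_diff_affine: "times_diff k q \<Longrightarrow> times_diff k (\<lambda>x. q (m * x + c))"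
proof (induction k arbitrary: q)
  case 0
  have "continuous_on UNIV (\<lambda>x::real. m * x + c)" by (intro continuous_intros)
  from continuous_on_compose2[OF _ this, of UNIV q] 0 show ?case by simp
next
  case (Suc k)
  then obtain q' where q: "\<forall>x. (q has_real_derivative q' x) (at x)" "times_diff k q'" by auto
  have "\<forall>x. ((\<lambda>x. q (m * x + c)) has_real_derivative q' (m * x + c) * m) (at x)"
  proof
    fix x
    have "((\<lambda>x. m * x + c) has_real_derivative m) (at x)"
      by (auto intro!: derivative_eq_intros)
    then show "((\<lambda>x. q (m * x + c)) has_real_derivative q' (m * x + c) * m) (at x)"
      by (rule DERIV_chain2[OF q(1)[rule_format]])
  qed
  moreover have "times_diff k (\<lambda>x. q' (m * x + c) * m)"
    by (rule times_diff_mult[OF Suc.IH[OF q(2)] times_diff_const])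
  ultimately show ?case by (rule times_diff_SucI)
qed

text \<open>
  The derivative of $x^{-m}e^{-1/x}$ is a linear combination of two functions of the same family.
  With the exponent \<open>m\<close> as a parameter, the smoothness of $e^{-1/x}$ at the origin is a plain
  induction.
\<close>

definition flat_exp :: "nat \<Rightarrow> real \<Rightarrow> real" where
  "flat_exp m x = (if x > 0 then (1 / x) ^ m * exp (- (1 / x)) else 0)"

lemma flat_exp_deriv:
  "(flat_exp m has_real_derivative flat_exp (m + 2) x - real m * flat_exp (m + 1) x) (at x)"
proof -
  consider "x > 0" | "x < 0" | "x = 0" by linarith
  then show ?thesis
  proof cases
    case 1
    have *: "((\<lambda>x. (1 / x) ^ m * exp (- (1 / x))) has_real_derivative
        flat_exp (m + 2) x - real m * flat_exp (m + 1) x) (at x)"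
    proof (cases m)
      case 0
      then show ?thesis using 1
        by (auto intro!: derivative_eq_intros simp: flat_exp_def power2_eq_square)
    next
      case (Suc j)
      have "((\<lambda>x::real. 1 / x) has_real_derivative - (1 / x\<^sup>2)) (at x)"
        using 1 by (auto intro!: derivative_eq_intros simp: power2_eq_square)
      from DERIV_power_Suc[OF this, of j]
      have p: "((\<lambda>x. (1 / x) ^ Suc j) has_real_derivative
          (1 + real j) * (- (1 / x\<^sup>2) * (1 / x) ^ j)) (at x)" .
      have e: "((\<lambda>x. exp (- (1 / x))) has_real_derivative (1 / x)\<^sup>2 * exp (- (1 / x))) (at x)"
        using 1 by (auto intro!: derivative_eq_intros simp: power2_eq_square)
      show ?thesis
        unfolding Suc by (rule DERIV_cong[OF DERIV_mult[OF p e]])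
          (use 1 in \<open>simp add: flat_exp_def power2_eq_square algebra_simps\<close>)
    qed
    show ?thesis
      by (rule has_field_derivative_transform_within_open[OF *, of "{0<..}"])
        (use 1 in \<open>auto simp: flat_exp_def\<close>)
  next
    case 2
    show ?thesis
      by (rule has_field_derivative_transform_within_open[of "\<lambda>x. 0" _ _ "{..<0}"])
        (use 2 in \<open>auto simp: flat_exp_def\<close>)
  next
    case 3
    \<comment> \<open>At the origin the difference quotient from the right is \<open>z ^ Suc m / exp z\<close> with \<open>z = 1 / h\<close>.\<close>
    have "((\<lambda>z. z ^ (Suc m) / exp z) \<longlongrightarrow> (0::real)) at_top"
      by (rule tendsto_power_div_exp_0)
    then have "((\<lambda>h. (inverse h) ^ (Suc m) / exp (inverse h)) \<longlongrightarrow> (0::real)) (at_right 0)"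
      by (rule filterlim_compose) (rule filterlim_inverse_at_top_right)
    then have R: "((\<lambda>h. flat_exp m h / h) \<longlongrightarrow> (0::real)) (at_right 0)"
      by (rule Lim_transform_eventually)
        (auto simp: eventually_at_filter flat_exp_def exp_minus field_simps)
    have L: "((\<lambda>h. flat_exp m h / h) \<longlongrightarrow> (0::real)) (at_left 0)"
      by (rule Lim_transform_eventually[of "\<lambda>x. 0"])
        (auto simp: eventually_at_filter flat_exp_def)
    have "((\<lambda>h. flat_exp m h / h) \<longlongrightarrow> (0::real)) (at 0)"
      using L R by (rule filterlim_split_at_real)
    then show ?thesis using 3 by (simp add: DERIV_def flat_exp_def)
  qed
qed

lemma times_diff_flat_exp: "times_diff k (flat_exp m)"
proof (induction k arbitrary: m)
  case 0
  show ?case using flat_exp_deriv[of m]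
    by (auto simp: continuous_on_eq_continuous_at dest: DERIV_isCont)
next
  case (Suc k)
  have "times_diff k (\<lambda>x. flat_exp (m + 2) x + - real m * flat_exp (m + 1) x)"
    by (intro times_diff_add times_diff_mult times_diff_const Suc)
  then have "times_diff k (\<lambda>x. flat_exp (m + 2) x - real m * flat_exp (m + 1) x)" by simp
  then show ?case using flat_exp_deriv[of m] by (intro times_diff_SucI allI)
qed

text \<open>
  The scaling by \<open>n\<close> steepens the flanks: as \<open>n\<close> grows, the bump increases to the indicator of the
  open interval between \<open>a\<close> and \<open>c\<close>.
\<close>

definition bump :: "nat \<Rightarrow> real \<Rightarrow> real \<Rightarrow> real \<Rightarrow> real" where
  "bump n a c x = flat_exp 0 (real n * (x - a)) * flat_exp 0 (real n * (c - x))"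

lemma times_diff_bump: "times_diff k (bump n a c)"
proof -
  have "times_diff k (\<lambda>x. flat_exp 0 (real n * x + (- (real n * a))) * flat_exp 0 (- real n * x + real n * c))"
    by (rule times_diff_mult[OF times_diff_affine[OF times_diff_flat_exp] times_diff_affine[OF times_diff_flat_exp]])
  moreover have "bump n a c = (\<lambda>x. flat_exp 0 (real n * x + (- (real n * a))) * flat_exp 0 (- real n * x + real n * c))"
    by (simp add: bump_def fun_eq_iff right_diff_distrib)
  ultimately show ?thesis by simp
qed

lemma bump_nonneg: "0 \<le> bump n a c x"
  and bump_le_1: "bump n a c x \<le> 1"
  and bump_outside: "x \<notin> {a<..<c} \<Longrightarrow> bump n a c x = 0"
proof -
  have *: "0 \<le> flat_exp 0 z" "flat_exp 0 z \<le> 1" for z by (auto simp: flat_exp_def)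
  show "0 \<le> bump n a c x" "bump n a c x \<le> 1"
    unfolding bump_def using * by (auto intro: mult_le_one)
  show "bump n a c x = 0" if "x \<notin> {a<..<c}"
    using that by (auto simp: bump_def flat_exp_def zero_less_mult_iff)
qed

lemma bump_tendsto: "(\<lambda>n. bump n a c x) \<longlonglongrightarrow> indicator {a<..<c} x"
proof (cases "x \<in> {a<..<c}")
  case True
  have F: "(\<lambda>n. flat_exp 0 (real n * z)) \<longlonglongrightarrow> 1" if "z > 0" for z
  proof -
    have "(\<lambda>n. exp (- (inverse z * inverse (real n)))) \<longlonglongrightarrow> exp (- (inverse z * 0))"
      by (intro tendsto_intros lim_inverse_n)
    then have "(\<lambda>n. exp (- (inverse z * inverse (real n)))) \<longlonglongrightarrow> 1" by simp
    then show ?thesis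
      by (rule Lim_transform_eventually)
        (use that in \<open>auto intro!: eventually_sequentiallyI[of 1] simp: flat_exp_def field_simps\<close>)
  qed
  have "(\<lambda>n. bump n a c x) \<longlonglongrightarrow> 1 * 1"
    unfolding bump_def using True by (intro tendsto_mult F) auto
  with True show ?thesis by simp
next
  case False
  then show ?thesis by (simp add: bump_outside)
qed

lemma bump_shift: "bump n a c (x - t) = bump n (a + t) (c + t) x"
  by (simp add: bump_def algebra_simps)

text \<open>
  A partial derivative of a product of functions of one coordinate each replaces a single factor.
  The class of these products is therefore closed under partial derivatives, which gives
  all orders of differentiability at once.
\<close>

definition tensor :: "('d::finite \<Rightarrow> real \<Rightarrow> real) \<Rightarrow> real ^ 'd \<Rightarrow> complex" where
  "tensor q x = complex_of_real (\<Prod>i\<in>UNIV. q i (x $ i))"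

lemma tensor_has_derivative:
  assumes "\<And>i x. (q i has_real_derivative q' i x) (at x)"
  shows "(tensor q has_derivative (\<lambda>v. \<Sum>i\<in>UNIV. v $ i *\<^sub>R tensor (q(i := q' i)) x)) (at x)"
proof -
  have 1: "((\<lambda>x. q i (x $ i)) has_derivative (\<lambda>v. v $ i * q' i (x $ i))) (at x)" for i
  proof -
    have "((\<lambda>x. x $ i) has_derivative (\<lambda>v. v $ i)) (at x)"
      by (rule bounded_linear_imp_has_derivative) (rule bounded_linear_vec_nth)
    from has_derivative_compose[OF this assms[unfolded has_field_derivative_def]]
    have "((\<lambda>x. q i (x $ i)) has_derivative (\<lambda>v. q' i (x $ i) * v $ i)) (at x)" .
    then show ?thesis by (simp only: mult.commute)
  qed
  have "((\<lambda>x. \<Prod>i\<in>UNIV. q i (x $ i)) has_derivative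
      (\<lambda>v. \<Sum>i\<in>UNIV. (v $ i * q' i (x $ i)) * (\<Prod>j\<in>UNIV - {i}. q j (x $ j)))) (at x)"
    by (rule has_derivative_prod[where f="\<lambda>i x. q i (x $ i)" and f'="\<lambda>i v. v $ i * q' i (x $ i)"]) (rule 1)
  then have *: "(tensor q has_derivative
      (\<lambda>v. complex_of_real (\<Sum>i\<in>UNIV. (v $ i * q' i (x $ i)) * (\<Prod>j\<in>UNIV - {i}. q j (x $ j))))) (at x)"
    unfolding tensor_def[abs_def] by (rule has_derivative_of_real)
  have "tensor (q(i := q' i)) x = complex_of_real (q' i (x $ i) * (\<Prod>j\<in>UNIV - {i}. q j (x $ j)))" for i
  proof -
    have "(\<Prod>j\<in>UNIV. (q(i := q' i)) j (x $ j))
      = (q(i := q' i)) i (x $ i) * (\<Prod>j\<in>UNIV - {i}. (q(i := q' i)) j (x $ j))"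
      by (rule prod.remove) auto
    also have "(\<Prod>j\<in>UNIV - {i}. (q(i := q' i)) j (x $ j)) = (\<Prod>j\<in>UNIV - {i}. q j (x $ j))"
      by (rule prod.cong) auto
    finally show ?thesis by (simp only: tensor_def fun_upd_same)
  qed
  then have "complex_of_real (\<Sum>i\<in>UNIV. (v $ i * q' i (x $ i)) * (\<Prod>j\<in>UNIV - {i}. q j (x $ j)))
      = (\<Sum>i\<in>UNIV. v $ i *\<^sub>R tensor (q(i := q' i)) x)" for v
    by (simp only: scaleR_conv_of_real of_real_sum of_real_mult mult.assoc)
  with * show ?thesis by (simp only:)
qed

lemma partial_deriv_tensor:
  assumes "\<And>i x. (q i has_real_derivative q' i x) (at x)"
  shows "partial_deriv (axis i 1) (tensor q) = tensor (q(i := q' i))"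
proof
  fix x
  have "frechet_derivative (tensor q) (at x) = (\<lambda>v. \<Sum>i\<in>UNIV. v $ i *\<^sub>R tensor (q(i := q' i)) x)"
    using tensor_has_derivative[of q q', OF assms] by (rule frechet_derivative_at[symmetric])
  moreover have "(\<Sum>j\<in>UNIV. axis i (1::real) $ j *\<^sub>R tensor (q(j := q' j)) x) = tensor (q(i := q' i)) x"
    by (subst sum.remove[of _ i]) (auto simp: axis_def intro!: sum.neutral)
  ultimately show "partial_deriv (axis i 1) (tensor q) x = tensor (q(i := q' i)) x"
    by (simp add: partial_deriv_def)
qed

lemma continuous_tensor:
  assumes "\<And>i::'d::finite. continuous_on UNIV (q i)"
  shows "continuous_on UNIV (tensor q :: real ^ 'd \<Rightarrow> complex)"
proof -
  have "continuous_on UNIV (\<lambda>x::real ^ 'd. q i (x $ i))" for i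
    using continuous_on_compose2[of UNIV "q i" UNIV "\<lambda>x. x $ i"] assms
    by (simp add: linear_continuous_on[OF bounded_linear_vec_nth])
  then show ?thesis
    unfolding tensor_def[abs_def] by (rule continuous_on_of_real[OF continuous_on_prod])
qed

lemma Ck_tensor: "(\<And>i. times_diff k (q i)) \<Longrightarrow> Ck k (tensor q)"
proof (induction k arbitrary: q)
  case 0
  then show ?case by (simp add: continuous_tensor)
next
  case (Suc k)
  then have "\<forall>i. \<exists>q'. (\<forall>x. (q i has_real_derivative q' x) (at x)) \<and> times_diff k q'" by auto
  then obtain q' where q': "\<And>i x. (q i has_real_derivative q' i x) (at x)" "\<And>i. times_diff k (q' i)"
    using choice[of "\<lambda>i q'. (\<forall>x. (q i has_real_derivative q' x) (at x)) \<and> times_diff k q'"] by blast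
  have "times_diff k (q i)" for i using Suc.prems times_diff_Suc by blast
  then have "Ck k (tensor (q(i := q' i)))" for i
    using q'(2) by (intro Suc.IH) auto
  moreover have "tensor q differentiable_on UNIV"
    using tensor_has_derivative[of q q', OF q'(1)] by (auto simp: differentiable_on_def differentiable_def)
  ultimately show ?case
    using partial_deriv_tensor[of q q', OF q'(1)] by (auto simp: Basis_vec_def)
qed

definition box_bump :: "nat \<Rightarrow> real ^ 'd \<Rightarrow> real ^ 'd \<Rightarrow> real ^ 'd \<Rightarrow> complex" where
  "box_bump n a c = tensor (\<lambda>i. bump n (a $ i) (c $ i))"

lemma box_bump_outside:
  assumes "x \<notin> box a c" shows "box_bump n a c x = 0"
proof -
  obtain i where "x $ i \<notin> {a $ i<..<c $ i}" using assms by (auto simp: mem_box_cart)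
  then have "bump n (a $ i) (c $ i) (x $ i) = 0" by (rule bump_outside)
  then show ?thesis by (auto simp: box_bump_def tensor_def)
qed

lemma box_bump_test: "box_bump n a c \<in> test_functions"
proof -
  have "{x. box_bump n a c x \<noteq> 0} \<subseteq> cbox a c"
    using box_bump_outside box_subset_cbox by blast
  then have "closure {x. box_bump n a c x \<noteq> 0} \<subseteq> cbox a c"
    by (simp add: closure_minimal closed_cbox)
  then have "compact (closure {x. box_bump n a c x \<noteq> 0})"
    by (meson bounded_cbox bounded_subset closed_closure compact_eq_bounded_closed)
  then show ?thesis
    unfolding test_functions_def box_bump_def by (auto intro!: Ck_tensor times_diff_bump)
qed

lemma norm_box_bump_le: "norm (box_bump n a c x) \<le> indicator (box a c) x"
proof (cases "x \<in> box a c")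
  case True
  have "norm (box_bump n a c x) = (\<Prod>i\<in>UNIV. bump n (a $ i) (c $ i) (x $ i))"
    unfolding box_bump_def tensor_def norm_of_real
    by (rule abs_of_nonneg) (intro prod_nonneg bump_nonneg ballI)
  also have "\<dots> \<le> 1" by (intro prod_le_1 conjI bump_nonneg bump_le_1)
  finally show ?thesis using True by simp
qed (simp add: box_bump_outside)

lemma box_bump_tendsto: "(\<lambda>n. box_bump n a c x) \<longlonglongrightarrow> indicator (box a c) x"
proof -
  have "(\<lambda>n. box_bump n a c x) \<longlonglongrightarrow> complex_of_real (\<Prod>i\<in>UNIV. indicator {a $ i<..<c $ i} (x $ i))"
    unfolding box_bump_def tensor_def by (intro tendsto_intros bump_tendsto)
  moreover have "complex_of_real (\<Prod>i\<in>UNIV. indicator {a $ i<..<c $ i} (x $ i)) = indicator (box a c) x"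
  proof (cases "x \<in> box a c")
    case False
    then obtain i where "x $ i \<notin> {a $ i<..<c $ i}" by (auto simp: mem_box_cart)
    then have "indicator {a $ i<..<c $ i} (x $ i) = (0::real)" by simp
    then show ?thesis using False by auto
  qed (simp add: mem_box_cart)
  ultimately show ?thesis by simp
qed

lemma box_bump_shift: "box_bump n a c (x - v) = box_bump n (a + v) (c + v) x"
  by (simp add: box_bump_def tensor_def bump_shift)

lemma box_bump_measurable [measurable]: "box_bump n a c \<in> borel_measurable borel"
proof (rule borel_measurable_continuous_onI)
  show "continuous_on UNIV (box_bump n a c)"
    unfolding box_bump_def
    by (intro continuous_tensor times_diff_continuous[OF times_diff_bump[of 0]])
qed

lemma box_bump_has_derivative:
  "(box_bump n a c has_derivative
     (\<lambda>v. \<Sum>i\<in>UNIV. v $ i *\<^sub>R partial_deriv (axis i 1) (box_bump n a c) x)) (at x)"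
proof -
  have "\<forall>i. \<exists>q'. \<forall>x. (bump n (a $ i) (c $ i) has_real_derivative q' x) (at x)"
    using times_diff_bump[of "Suc 0"] unfolding times_diff.simps by blast
  from choice[OF this] obtain q' where q': "\<And>i x. (bump n (a $ i) (c $ i) has_real_derivative q' i x) (at x)"
    by blast
  show ?thesis
    unfolding box_bump_def partial_deriv_tensor[of _ q', OF q']
    by (rule tensor_has_derivative[OF q'])
qed

lemma continuous_partial_deriv_box_bump:
  fixes a c :: "real ^ 'd"
  shows "continuous_on UNIV (partial_deriv (axis i 1) (box_bump n a c))"
proof -
  have "Ck 1 (box_bump n a c)" using box_bump_test[of n a c] by (auto simp: test_functions_def)
  moreover have "axis i (1::real) \<in> Basis" by (simp add: axis_in_Basis_iff)
  ultimately show ?thesis by auto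
qed

lemma partial_deriv_box_bump_outside:
  assumes "x \<notin> cbox a c"
  shows "partial_deriv (axis i 1) (box_bump n a c) x = 0"
proof -
  have "((\<lambda>x. 0) has_derivative (\<lambda>v. 0)) (at x)" by simp
  then have "(box_bump n a c has_derivative (\<lambda>v. 0)) (at x)"
    by (rule has_derivative_transform_within_open[of _ _ _ _ "- cbox a c"])
      (use assms box_bump_outside[of _ a c n] box_subset_cbox[of a c] in \<open>auto simp: subset_eq open_Compl\<close>)
  then show ?thesis unfolding partial_deriv_def by (simp add: frechet_derivative_at[symmetric])
qed

section \<open>Differences of Sobolev functions as line integrals\<close>

lemma nn_integral_translate:
  fixes f :: "'a::euclidean_space \<Rightarrow> ennreal"
  assumes [measurable]: "f \<in> borel_measurable borel"
  shows "(\<integral>\<^sup>+x. f (x + v) \<partial>lborel) = (\<integral>\<^sup>+x. f x \<partial>lborel)"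
proof -
  have "(\<integral>\<^sup>+x. f x \<partial>lborel) = (\<integral>\<^sup>+x. f x \<partial>distr lborel borel ((+) v))"
    by (simp only: lborel_distr_plus)
  also have "\<dots> = (\<integral>\<^sup>+x. f (v + x) \<partial>lborel)" by (rule nn_integral_distr) auto
  finally show ?thesis by (simp add: add.commute)
qed

lemma integral_translate:
  fixes f :: "'a::euclidean_space \<Rightarrow> 'b::{banach, second_countable_topology}"
  assumes [measurable]: "f \<in> borel_measurable borel"
  shows "(\<integral>x. f (x + v) \<partial>lborel) = (\<integral>x. f x \<partial>lborel)"
proof -
  have "(\<integral>x. f x \<partial>lborel) = (\<integral>x. f x \<partial>distr lborel borel ((+) v))"
    by (simp only: lborel_distr_plus)
  also have "\<dots> = (\<integral>x. f (v + x) \<partial>lborel)" by (rule integral_distr) auto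
  finally show ?thesis by (simp add: add.commute)
qed

lemma Lp_norm_finite_iff:
  "Lp_norm (numeral k) f < \<infinity> \<longleftrightarrow> (\<integral>\<^sup>+x. ennreal (norm (f x) ^ numeral k) \<partial>lborel) < \<infinity>"
  and Lp_norm_power:
  "enn2real (Lp_norm (numeral k) f) ^ numeral k = enn2real (\<integral>\<^sup>+x. ennreal (norm (f x) ^ numeral k) \<partial>lborel)"
proof -
  have e: "enn2real (numeral k) = numeral k"
    by (metis enn2real_ennreal ennreal_numeral zero_le_numeral)
  have n: "(numeral k :: ennreal) \<noteq> \<infinity>" by simp
  show "Lp_norm (numeral k) f < \<infinity> \<longleftrightarrow> (\<integral>\<^sup>+x. ennreal (norm (f x) ^ numeral k) \<partial>lborel) < \<infinity>"
    unfolding Lp_norm_def Let_def e if_not_P[OF n] by (simp add: less_top)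
  have *: "(z powr (1 / numeral k)) ^ numeral k = z" if "0 \<le> z" for z :: real
  proof -
    have "(z powr (1 / numeral k)) ^ numeral k = (z powr (1 / numeral k)) powr (numeral k)"
      by (rule powr_numeral[symmetric]) simp
    also have "\<dots> = z" using that by (simp add: powr_powr)
    finally show ?thesis .
  qed
  show "enn2real (Lp_norm (numeral k) f) ^ numeral k = enn2real (\<integral>\<^sup>+x. ennreal (norm (f x) ^ numeral k) \<partial>lborel)"
    unfolding Lp_norm_def Let_def e if_not_P[OF n] by (simp add: * )
qed

lemma L2_measurable: "f \<in> L2 \<Longrightarrow> f \<in> borel_measurable borel"
  by (simp add: L2_def)

lemma L2_finite: "f \<in> L2 \<Longrightarrow> (\<integral>\<^sup>+x. ennreal (norm (f x) ^ 2) \<partial>lborel) < \<infinity>"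
  unfolding L2_def using Lp_norm_finite_iff[of "Num.Bit0 Num.One" f] by simp

lemma nn_integral_norm_indicator_le:
  assumes [measurable]: "f \<in> borel_measurable borel" "B \<in> sets borel" and "0 \<le> c"
  shows "(\<integral>\<^sup>+x. ennreal (c * norm (f x) * indicator B x) \<partial>lborel)
    \<le> ennreal (c\<^sup>2) * (\<integral>\<^sup>+x. ennreal (norm (f x) ^ 2) \<partial>lborel) + emeasure lborel B"
proof -
  have "(\<integral>\<^sup>+x. ennreal (c * norm (f x) * indicator B x) \<partial>lborel)
    \<le> (\<integral>\<^sup>+x. ennreal (c\<^sup>2) * ennreal (norm (f x) ^ 2) + indicator B x \<partial>lborel)"
  proof (rule nn_integral_mono)
    fix x
    have "c * norm (f x) \<le> c\<^sup>2 * norm (f x) ^ 2 + 1"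
      using zero_le_power2[of "c * norm (f x) - 1"] mult_nonneg_nonneg[OF assms(3) norm_ge_zero[of "f x"]]
      by (simp add: power2_diff power_mult_distrib)
    then have "ennreal (c * norm (f x) * indicator B x) \<le> ennreal (c\<^sup>2 * norm (f x) ^ 2 + indicator B x)"
      by (intro ennreal_leI) (auto simp: indicator_def)
    also have "\<dots> = ennreal (c\<^sup>2) * ennreal (norm (f x) ^ 2) + indicator B x"
      by (simp add: ennreal_plus ennreal_mult ennreal_indicator)
    finally show "ennreal (c * norm (f x) * indicator B x)
      \<le> ennreal (c\<^sup>2) * ennreal (norm (f x) ^ 2) + indicator B x" .
  qed
  also have "\<dots> = ennreal (c\<^sup>2) * (\<integral>\<^sup>+x. ennreal (norm (f x) ^ 2) \<partial>lborel) + emeasure lborel B"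
    by (subst nn_integral_add) (auto simp: nn_integral_cmult)
  finally show ?thesis .
qed

definition directional :: "real ^ 'd \<Rightarrow> (real ^ 'd \<Rightarrow> complex ^ 'd) \<Rightarrow> real ^ 'd \<Rightarrow> complex" where
  "directional h G x = (\<Sum>i\<in>UNIV. (h $ i) *\<^sub>R (G x $ i))"

lemma norm_directional_le: "norm (directional h G x) \<le> norm h * norm (G x)"
proof -
  have "norm (directional h G x) \<le> (\<Sum>i\<in>UNIV. norm ((h $ i) *\<^sub>R (G x $ i)))"
    unfolding directional_def by (rule norm_sum)
  also have "\<dots> = (\<Sum>i\<in>UNIV. \<bar>h $ i\<bar> * \<bar>norm (G x $ i)\<bar>)" by simp
  also have "\<dots> \<le> L2_set (\<lambda>i. h $ i) UNIV * L2_set (\<lambda>i. norm (G x $ i)) UNIV"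
    by (rule L2_set_mult_ineq)
  finally show ?thesis by (simp add: norm_vec_def L2_set_def)
qed

lemma vec_nth_measurable [measurable]:
  "(\<lambda>x :: 'a::euclidean_space ^ 'd. x $ i) \<in> borel_measurable borel"
  by (intro borel_measurable_continuous_onI linear_continuous_on bounded_linear_vec_nth)

lemma directional_measurable [measurable]:
  assumes [measurable]: "G \<in> borel_measurable borel"
  shows "directional h G \<in> borel_measurable borel"
proof -
  have "(\<lambda>x. G x $ i) \<in> borel_measurable borel" for i
    by (rule measurable_compose[OF assms vec_nth_measurable])
  then show ?thesis unfolding directional_def[abs_def] by measurable
qed

text \<open>
  This exchanges the parameter along a segment with the space variable. The hypothesis is a bound
  on all slices by one constant, because slices at different times are translates of each
  other and Lebesgue measure is translation invariant.
\<close>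

lemma fubini_strip:
  fixes q :: "'a::euclidean_space \<Rightarrow> real \<Rightarrow> complex"
  assumes [measurable]: "(\<lambda>(x, t). q x t) \<in> borel_measurable (borel \<Otimes>\<^sub>M borel)"
    and bd: "\<And>t. (\<integral>\<^sup>+x. ennreal (norm (q x t)) \<partial>lborel) \<le> B" and B: "B < \<infinity>"
  shows "integrable (lborel \<Otimes>\<^sub>M lborel) (\<lambda>(x, t). indicator {0..s} t *\<^sub>R q x t)"
    and "(\<integral>x. (\<integral>t. indicator {0..s} t *\<^sub>R q x t \<partial>lborel) \<partial>lborel)
       = (\<integral>t. indicator {0..s} t *\<^sub>R (\<integral>x. q x t \<partial>lborel) \<partial>lborel)"
proof -
  let ?f = "\<lambda>(x, t). indicator {0..s} t *\<^sub>R q x t"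
  have m[measurable]: "?f \<in> borel_measurable (lborel \<Otimes>\<^sub>M lborel)" by measurable
  have "(\<integral>\<^sup>+z. ennreal (norm (?f z)) \<partial>(lborel \<Otimes>\<^sub>M lborel))
      = (\<integral>\<^sup>+t. (\<integral>\<^sup>+x. ennreal (norm (?f (x, t))) \<partial>lborel) \<partial>lborel)"
    by (rule lborel_pair.nn_integral_snd[symmetric]) measurable
  also have "\<dots> \<le> (\<integral>\<^sup>+t. B * indicator {0..s} t \<partial>lborel)"
  proof (rule nn_integral_mono)
    fix t
    show "(\<integral>\<^sup>+x. ennreal (norm (?f (x, t))) \<partial>lborel) \<le> B * indicator {0..s} t"
      using bd[of t] by (auto simp: indicator_def)
  qed
  also have "\<dots> = B * emeasure lborel {0..s}" by (rule nn_integral_cmult_indicator) simp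
  also have "\<dots> < \<infinity>" using B by (auto simp: ennreal_mult_less_top emeasure_lborel_Icc_eq)
  finally show int: "integrable (lborel \<Otimes>\<^sub>M lborel) ?f" by (intro integrableI_bounded m)
  have "(\<integral>t. (\<integral>x. indicator {0..s} t *\<^sub>R q x t \<partial>lborel) \<partial>lborel)
      = (\<integral>x. (\<integral>t. indicator {0..s} t *\<^sub>R q x t \<partial>lborel) \<partial>lborel)"
    using lborel_pair.Fubini_integral[OF int] .
  then show "(\<integral>x. (\<integral>t. indicator {0..s} t *\<^sub>R q x t \<partial>lborel) \<partial>lborel)
       = (\<integral>t. indicator {0..s} t *\<^sub>R (\<integral>x. q x t \<partial>lborel) \<partial>lborel)" by simp
qed

text \<open>
  In the limit the bumps become indicators of boxes. Boxes form a generator of the Borel sets that is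
  stable under intersection, so the integral of \<open>v\<close> vanishes over every Borel subset of a large box.
\<close>

lemma AE_zero_if_bump_integrals_zero:
  fixes v :: "real ^ 'd \<Rightarrow> complex"
  assumes [measurable]: "v \<in> borel_measurable borel"
    and int: "\<And>a c. integrable lborel (\<lambda>x. indicator (box a c) x *\<^sub>R v x)"
    and zero: "\<And>n a c. (\<integral>x. v x * box_bump n a c x \<partial>lborel) = 0"
  shows "AE x in lborel. v x = 0"
proof -
  have box0: "(\<integral>x. indicator (box a c) x *\<^sub>R v x \<partial>lborel) = 0" for a c
  proof -
    have "(\<lambda>n. \<integral>x. v x * box_bump n a c x \<partial>lborel) \<longlonglongrightarrow> (\<integral>x. indicator (box a c) x *\<^sub>R v x \<partial>lborel)"
    proof (rule integral_dominated_convergence)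
      show "integrable lborel (\<lambda>x. norm (indicator (box a c) x *\<^sub>R v x))"
        by (intro integrable_norm int)
      show "AE x in lborel. (\<lambda>n. v x * box_bump n a c x) \<longlonglongrightarrow> indicator (box a c) x *\<^sub>R v x"
      proof (rule AE_I2)
        fix x
        have "(\<lambda>n. v x * box_bump n a c x) \<longlonglongrightarrow> v x * indicator (box a c) x"
          by (intro tendsto_mult tendsto_const box_bump_tendsto)
        then show "(\<lambda>n. v x * box_bump n a c x) \<longlonglongrightarrow> indicator (box a c) x *\<^sub>R v x"
          by (cases "x \<in> box a c") simp_all
      qed
      show "AE x in lborel. norm (v x * box_bump n a c x) \<le> norm (indicator (box a c) x *\<^sub>R v x)" for n
      proof (rule AE_I2)
        fix x
        show "norm (v x * box_bump n a c x) \<le> norm (indicator (box a c) x *\<^sub>R v x)"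
          using mult_left_mono[OF norm_box_bump_le[of n a c x], of "norm (v x)"]
          by (simp add: norm_mult mult.commute)
      qed
    qed measurable
    then show ?thesis unfolding zero using LIMSEQ_unique tendsto_const by blast
  qed
  define K where "K n = box ((\<chi> i. - real n) :: real ^ 'd) (\<chi> i. real n)" for n :: nat
  have "AE x in lborel. indicator (K n) x *\<^sub>R v x = (0::complex)" for n
  proof (rule sigma_finite_measure.density_zero[OF sigma_finite_lborel])
    let ?w = "\<lambda>x. indicator (K n) x *\<^sub>R v x"
    show intw: "integrable lborel ?w" unfolding K_def by (rule int)
    have set_int: "set_integrable lborel A ?w" if "A \<in> sets borel" for A
      unfolding set_integrable_def using that by (intro integrable_mult_indicator intw) simp
    fix A :: "(real ^ 'd) set"
    assume "A \<in> sets lborel"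
    then have A: "A \<in> sigma_sets UNIV (range (\<lambda>(a, b). box a b))"
      by (simp add: borel_eq_box)
    have in_borel: "S \<in> sets borel" if "S \<in> sigma_sets UNIV (range (\<lambda>(a, b). box a b))"
      for S :: "(real ^ 'd) set" using that by (simp add: borel_eq_box)
    have "Int_stable (range (\<lambda>(a, b). box a b :: (real ^ 'd) set))"
      by (auto simp: Int_stable_def box_Int_box)
    moreover have "range (\<lambda>(a, b). box a b :: (real ^ 'd) set) \<subseteq> Pow UNIV" by simp
    ultimately show "set_lebesgue_integral lborel A ?w = 0"
      using A
    proof (induction rule: sigma_sets_induct_disjoint)
      case (basic A)
      then obtain a b where "A = box a b" by auto
      then obtain a' b' where ab: "A \<inter> K n = box a' b'" by (auto simp: K_def box_Int_box)
      have "set_lebesgue_integral lborel A ?w = (\<integral>x. indicator (A \<inter> K n) x *\<^sub>R v x \<partial>lborel)"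
        unfolding set_lebesgue_integral_def by (simp add: indicator_inter_arith)
      then show ?case using box0 unfolding ab by simp
    next
      case empty
      show ?case by (simp add: set_lebesgue_integral_def)
    next
      case (compl A)
      have [measurable]: "A \<in> sets borel" using compl in_borel by simp
      have "0 = integral\<^sup>L lborel ?w" unfolding K_def by (simp only: box0)
      also have "\<dots> = set_lebesgue_integral lborel (A \<union> (UNIV - A)) ?w"
        by (simp add: set_lebesgue_integral_def)
      also have "\<dots> = set_lebesgue_integral lborel A ?w + set_lebesgue_integral lborel (UNIV - A) ?w"
        by (rule set_integral_Un) (auto intro!: set_int)
      finally show ?case using compl by simp
    next
      case (union A)
      have [measurable]: "A i \<in> sets borel" for i using union(2) in_borel by auto
      have "set_lebesgue_integral lborel (\<Union>i. A i) ?w = (\<Sum>i. set_lebesgue_integral lborel (A i) ?w)"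
        by (rule lebesgue_integral_countable_add)
          (use union(1) in \<open>auto intro!: set_int simp: disjoint_family_on_def\<close>)
      then show ?case using union(3) by simp
    qed
  qed
  then have "AE x in lborel. \<forall>n. indicator (K n) x *\<^sub>R v x = (0::complex)"
    unfolding AE_all_countable by blast
  then show ?thesis
  proof (rule AE_mp, intro AE_I2 impI)
    fix x assume 0: "\<forall>n. indicator (K n) x *\<^sub>R v x = (0::complex)"
    obtain n where n: "norm x < real n" using reals_Archimedean2 by blast
    have "x \<in> K n"
      unfolding K_def mem_box_cart
    proof
      fix i
      show "((\<chi> i. - real n) :: real ^ 'd) $ i < x $ i \<and> x $ i < ((\<chi> i. real n) :: real ^ 'd) $ i"
        using component_le_norm_cart[of x i] n by auto
    qed
    then show "v x = 0" using 0[rule_format, of n] by simp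
  qed
qed

lemma integrable_mult_bump:
  fixes f k :: "real ^ 'd \<Rightarrow> complex"
  assumes [measurable]: "f \<in> borel_measurable borel" "k \<in> borel_measurable borel" "B \<in> sets borel"
    and f: "(\<integral>\<^sup>+x. ennreal (norm (f x) ^ 2) \<partial>lborel) < \<infinity>"
    and k: "\<And>x. norm (k x) \<le> C * indicator B x" and C: "0 \<le> C"
    and B: "emeasure lborel B < \<infinity>"
  shows "integrable lborel (\<lambda>x. f x * k x)"
proof (rule integrableI_bounded)
  have "(\<integral>\<^sup>+x. ennreal (norm (f x * k x)) \<partial>lborel) \<le> (\<integral>\<^sup>+x. ennreal (C * norm (f x) * indicator B x) \<partial>lborel)"
  proof (intro nn_integral_mono ennreal_leI)
    fix x
    show "norm (f x * k x) \<le> C * norm (f x) * indicator B x"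
      using mult_left_mono[OF k[of x], of "norm (f x)"] by (simp add: norm_mult mult_ac)
  qed
  also have "\<dots> \<le> ennreal (C\<^sup>2) * (\<integral>\<^sup>+x. ennreal (norm (f x) ^ 2) \<partial>lborel) + emeasure lborel B"
    by (rule nn_integral_norm_indicator_le) (use C in auto)
  also have "\<dots> < \<infinity>" using f B by (auto simp: ennreal_mult_less_top)
  finally show "(\<integral>\<^sup>+x. ennreal (norm (f x * k x)) \<partial>lborel) < \<infinity>" .
qed measurable

lemma partial_deriv_box_bump_shift:
  "partial_deriv (axis i 1) (box_bump n a c) (x - v) = partial_deriv (axis i 1) (box_bump n (a + v) (c + v)) x"
proof -
  let ?D = "frechet_derivative (box_bump n a c) (at (x - v))"
  have "box_bump n a c differentiable (at (x - v))"
    using box_bump_has_derivative differentiableI by blast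
  then have D: "(box_bump n a c has_derivative ?D) (at (x - v))"
    by (simp add: frechet_derivative_works)
  have "((\<lambda>x. x - v) has_derivative (\<lambda>h. h)) (at x)"
    by (auto intro!: derivative_eq_intros)
  from has_derivative_compose[OF this D]
  have "(box_bump n (a + v) (c + v) has_derivative ?D) (at x)"
    unfolding box_bump_shift .
  then have "?D = frechet_derivative (box_bump n (a + v) (c + v)) (at x)"
    by (rule frechet_derivative_at)
  then show ?thesis by (simp add: partial_deriv_def)
qed

lemma partial_deriv_box_bump_bounded:
  fixes a c :: "real ^ 'd"
  shows "\<exists>C\<ge>0. \<forall>i x. norm (partial_deriv (axis i 1) (box_bump n a c) x) \<le> C * indicator (cbox a c) x"
proof -
  let ?p = "\<lambda>i. partial_deriv (axis i 1) (box_bump n a c)"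
  have "\<exists>b. \<forall>x\<in>cbox a c. norm (?p i x) \<le> b" for i
  proof -
    have "compact (?p i ` cbox a c)"
      by (intro compact_continuous_image compact_cbox continuous_on_subset[OF continuous_partial_deriv_box_bump]) auto
    then have "bounded (?p i ` cbox a c)" by (rule compact_imp_bounded)
    then show ?thesis unfolding bounded_iff by blast
  qed
  then obtain b where b: "\<And>i x. x \<in> cbox a c \<Longrightarrow> norm (?p i x) \<le> b i" by metis
  define C where "C = (\<Sum>i\<in>UNIV. \<bar>b i\<bar>)"
  have "b i \<le> C" for i
    unfolding C_def by (rule order_trans[OF abs_ge_self]) (rule member_le_sum; simp)
  with b have "norm (?p i x) \<le> C" if "x \<in> cbox a c" for i x
    using that order_trans by blast
  then have "norm (?p i x) \<le> C * indicator (cbox a c) x" for i x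
    by (cases "x \<in> cbox a c") (auto simp: partial_deriv_box_bump_outside)
  moreover have "0 \<le> C" unfolding C_def by (intro sum_nonneg) auto
  ultimately show ?thesis by blast
qed

lemma partial_deriv_box_bump_measurable [measurable]:
  fixes a c :: "real ^ 'd"
  shows "partial_deriv (axis i 1) (box_bump n a c) \<in> borel_measurable borel"
  by (rule borel_measurable_continuous_onI) (rule continuous_partial_deriv_box_bump)

lemma emeasure_cbox_finite: "emeasure lborel (cbox a c) < \<infinity>"
  by (metis emeasure_lborel_cbox_finite infinity_ennreal_def)

lemma emeasure_box_finite: "emeasure lborel (box a c) < \<infinity>"
  by (metis emeasure_lborel_box_finite infinity_ennreal_def)

lemma weak_gradient_bump:
  fixes u :: "real ^ 'd \<Rightarrow> complex"
  assumes u: "u \<in> L2" and G: "G \<in> L2" and w: "is_weak_gradient u G"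
  shows "(\<integral>x. u x * (\<Sum>i\<in>UNIV. h $ i *\<^sub>R partial_deriv (axis i 1) (box_bump n a c) x) \<partial>lborel)
    = - (\<integral>x. directional h G x * box_bump n a c x \<partial>lborel)"
proof -
  let ?p = "\<lambda>i. partial_deriv (axis i 1) (box_bump n a c)"
  have [measurable]: "u \<in> borel_measurable borel" "G \<in> borel_measurable borel"
    using u G by (auto intro: L2_measurable)
  obtain C where C: "0 \<le> C" "\<And>i x. norm (?p i x) \<le> C * indicator (cbox a c) x"
    using partial_deriv_box_bump_bounded[of n a c] by blast
  have i1: "integrable lborel (\<lambda>x. u x * ?p i x)" for i
    by (rule integrable_mult_bump[where B="cbox a c"])
      (use C L2_finite[OF u] emeasure_cbox_finite in auto)
  have Gi[measurable]: "(\<lambda>x. G x $ i) \<in> borel_measurable borel" for i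
    by (rule measurable_compose[OF _ vec_nth_measurable]) measurable
  have i2: "integrable lborel (\<lambda>x. G x $ i * box_bump n a c x)" for i
  proof (rule integrable_mult_bump[where B="box a c" and C=1])
    have "(\<integral>\<^sup>+x. ennreal (norm (G x $ i) ^ 2) \<partial>lborel) \<le> (\<integral>\<^sup>+x. ennreal (norm (G x) ^ 2) \<partial>lborel)"
      by (intro nn_integral_mono ennreal_leI power_mono Finite_Cartesian_Product.norm_nth_le) auto
    also note L2_finite[OF G]
    finally show "(\<integral>\<^sup>+x. ennreal (norm (G x $ i) ^ 2) \<partial>lborel) < \<infinity>" .
  qed (use norm_box_bump_le emeasure_box_finite in auto)
  have "(\<integral>x. u x * (\<Sum>i\<in>UNIV. h $ i *\<^sub>R ?p i x) \<partial>lborel)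
      = (\<integral>x. (\<Sum>i\<in>UNIV. h $ i *\<^sub>R (u x * ?p i x)) \<partial>lborel)"
    by (simp add: sum_distrib_left)
  also have "\<dots> = (\<Sum>i\<in>UNIV. h $ i *\<^sub>R (\<integral>x. u x * ?p i x \<partial>lborel))"
    by (subst Bochner_Integration.integral_sum) (auto intro!: i1)
  also have "\<dots> = (\<Sum>i\<in>UNIV. h $ i *\<^sub>R (- (\<integral>x. G x $ i * box_bump n a c x \<partial>lborel)))"
    using w box_bump_test[of n a c] unfolding is_weak_gradient_def by simp
  also have "\<dots> = - (\<Sum>i\<in>UNIV. h $ i *\<^sub>R (\<integral>x. G x $ i * box_bump n a c x \<partial>lborel))"
    by (simp add: sum_negf)
  also have "(\<Sum>i\<in>UNIV. h $ i *\<^sub>R (\<integral>x. G x $ i * box_bump n a c x \<partial>lborel))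
      = (\<integral>x. (\<Sum>i\<in>UNIV. h $ i *\<^sub>R (G x $ i * box_bump n a c x)) \<partial>lborel)"
    by (subst Bochner_Integration.integral_sum) (auto intro!: i2)
  finally show ?thesis by (simp add: directional_def sum_distrib_right)
qed

text \<open>
  The difference of the shifted bump is the integral of its derivative along the segment. For each
  time \<open>t\<close> the shifted bump is again a test function, so the derivative can be moved to \<open>u\<close>;
  a translation then moves the shift to the gradient.
\<close>

lemma bump_difference:
  fixes u :: "real ^ 'd \<Rightarrow> complex"
  assumes u: "u \<in> L2" and G: "G \<in> L2" and w: "is_weak_gradient u G" and s: "0 \<le> s"
  shows "(\<integral>x. u x * (box_bump n a c (x - s *\<^sub>R h) - box_bump n a c x) \<partial>lborel)
    = (\<integral>t. indicator {0..s} t *\<^sub>R (\<integral>x. directional h G (x + t *\<^sub>R h) * box_bump n a c x \<partial>lborel) \<partial>lborel)"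
proof -
  let ?p = "\<lambda>i. partial_deriv (axis i 1) (box_bump n a c)"
  define p where "p x t = (\<Sum>i\<in>UNIV. h $ i *\<^sub>R ?p i (x - t *\<^sub>R h))" for x t
  have [measurable]: "u \<in> borel_measurable borel" "G \<in> borel_measurable borel"
    using u G by (auto intro: L2_measurable)
  have line: "(\<integral>t. indicator {0..s} t *\<^sub>R (- p x t) \<partial>lborel)
      = box_bump n a c (x - s *\<^sub>R h) - box_bump n a c x" for x
  proof -
    have deriv: "((\<lambda>t. box_bump n a c (x - t *\<^sub>R h)) has_vector_derivative - p x t) (at t within {0..s})" for t
    proof -
      have "((\<lambda>t. x - t *\<^sub>R h) has_derivative (\<lambda>\<tau>. - (\<tau> *\<^sub>R h))) (at t)"
        by (auto intro!: derivative_eq_intros)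
      from has_derivative_compose[OF this box_bump_has_derivative]
      have "((\<lambda>t. box_bump n a c (x - t *\<^sub>R h)) has_derivative (\<lambda>\<tau>. \<tau> *\<^sub>R (- p x t))) (at t)"
        by (simp add: p_def scaleR_sum_right sum_negf[symmetric])
      then show ?thesis
        unfolding has_vector_derivative_def by (rule has_derivative_at_withinI)
    qed
    have "continuous_on {0..s} (\<lambda>t. - p x t)"
      unfolding p_def
      by (intro continuous_on_minus continuous_on_sum continuous_on_scaleR continuous_on_const
          continuous_on_compose2[OF continuous_partial_deriv_box_bump, of _ "\<lambda>t. x - t *\<^sub>R h"]
          continuous_on_diff continuous_on_id) auto
    from integral_FTC_Icc[OF s deriv this] show ?thesis by simp
  qed
  obtain C where C: "0 \<le> C" "\<And>i x. norm (?p i x) \<le> C * indicator (cbox a c) x"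
    using partial_deriv_box_bump_bounded[of n a c] by blast
  define C' where "C' = (\<Sum>i\<in>UNIV. \<bar>h $ i\<bar>) * C"
  have C': "0 \<le> C'" unfolding C'_def using C(1) by (intro mult_nonneg_nonneg sum_nonneg) auto
  have pb: "norm (p x t) \<le> C' * indicator (cbox a c) (x - t *\<^sub>R h)" for x t
  proof -
    have "norm (p x t) \<le> (\<Sum>i\<in>UNIV. norm (h $ i *\<^sub>R ?p i (x - t *\<^sub>R h)))"
      unfolding p_def by (rule norm_sum)
    also have "\<dots> \<le> (\<Sum>i\<in>UNIV. \<bar>h $ i\<bar> * (C * indicator (cbox a c) (x - t *\<^sub>R h)))"
      by (intro sum_mono) (simp add: mult_left_mono C(2))
    finally show ?thesis by (simp add: C'_def sum_distrib_right mult.assoc)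
  qed
  have "(\<integral>x. u x * (box_bump n a c (x - s *\<^sub>R h) - box_bump n a c x) \<partial>lborel)
      = (\<integral>x. (\<integral>t. indicator {0..s} t *\<^sub>R (u x * (- p x t)) \<partial>lborel) \<partial>lborel)"
  proof -
    have "(\<integral>t. indicator {0..s} t *\<^sub>R (u x * (- p x t)) \<partial>lborel)
        = u x * (\<integral>t. indicator {0..s} t *\<^sub>R (- p x t) \<partial>lborel)" for x
      by (subst integral_mult_right_zero[symmetric]) (simp only: mult_scaleR_right)
    then show ?thesis by (simp only: line)
  qed
  also have "\<dots> = (\<integral>t. indicator {0..s} t *\<^sub>R (\<integral>x. u x * (- p x t) \<partial>lborel) \<partial>lborel)"
  proof (rule fubini_strip(2))
    have "(\<lambda>(x, t). ?p i (x - t *\<^sub>R h)) \<in> borel_measurable (borel \<Otimes>\<^sub>M borel)" for i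
      by measurable
    then show "(\<lambda>(x, t). u x * - p x t) \<in> borel_measurable (borel \<Otimes>\<^sub>M borel)"
      unfolding p_def by measurable
    show "(\<integral>\<^sup>+x. ennreal (norm (u x * - p x t)) \<partial>lborel)
        \<le> ennreal (C'\<^sup>2) * (\<integral>\<^sup>+x. ennreal (norm (u x) ^ 2) \<partial>lborel) + emeasure lborel (cbox a c)" for t
    proof -
      let ?B = "{x. x - t *\<^sub>R h \<in> cbox a c}"
      have B: "?B \<in> sets borel" by measurable
      have "emeasure lborel ?B = (\<integral>\<^sup>+x. indicator (cbox a c) (x + (- (t *\<^sub>R h))) \<partial>lborel)"
        using nn_integral_indicator[of ?B lborel] B by (simp add: indicator_def)
      also have "\<dots> = emeasure lborel (cbox a c)"
        by (subst nn_integral_translate) auto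
      finally have eB: "emeasure lborel ?B = emeasure lborel (cbox a c)" .
      have "(\<integral>\<^sup>+x. ennreal (norm (u x * - p x t)) \<partial>lborel)
          \<le> (\<integral>\<^sup>+x. ennreal (C' * norm (u x) * indicator ?B x) \<partial>lborel)"
      proof (intro nn_integral_mono ennreal_leI)
        fix x
        show "norm (u x * - p x t) \<le> C' * norm (u x) * indicator ?B x"
          using mult_left_mono[OF pb[of x t], of "norm (u x)"] by (simp add: norm_mult mult_ac indicator_def)
      qed
      also have "\<dots> \<le> ennreal (C'\<^sup>2) * (\<integral>\<^sup>+x. ennreal (norm (u x) ^ 2) \<partial>lborel) + emeasure lborel ?B"
        by (rule nn_integral_norm_indicator_le) (use C' B in auto)
      finally show ?thesis unfolding eB .
    qed
    show "ennreal (C'\<^sup>2) * (\<integral>\<^sup>+x. ennreal (norm (u x) ^ 2) \<partial>lborel) + emeasure lborel (cbox a c) < \<infinity>"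
      using L2_finite[OF u] emeasure_cbox_finite by (auto simp: ennreal_mult_less_top)
  qed
  also have "\<dots> = (\<integral>t. indicator {0..s} t *\<^sub>R (\<integral>x. directional h G (x + t *\<^sub>R h) * box_bump n a c x \<partial>lborel) \<partial>lborel)"
  proof (rule Bochner_Integration.integral_cong[OF refl])
    fix t
    have "(\<integral>x. u x * (- p x t) \<partial>lborel) = - (\<integral>x. u x * p x t \<partial>lborel)" by simp
    also have "\<dots> = (\<integral>x. directional h G x * box_bump n a c (x - t *\<^sub>R h) \<partial>lborel)"
      unfolding p_def partial_deriv_box_bump_shift weak_gradient_bump[OF u G w] box_bump_shift by simp
    also have "\<dots> = (\<integral>x. directional h G (x + t *\<^sub>R h) * box_bump n a c (x + t *\<^sub>R h - t *\<^sub>R h) \<partial>lborel)"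
      by (subst integral_translate[symmetric, of _ "t *\<^sub>R h"]) measurable
    finally have e: "(\<integral>x. u x * (- p x t) \<partial>lborel)
      = (\<integral>x. directional h G (x + t *\<^sub>R h) * box_bump n a c x \<partial>lborel)" by simp
    show "indicator {0..s} t *\<^sub>R (\<integral>x. u x * (- p x t) \<partial>lborel)
      = indicator {0..s} t *\<^sub>R (\<integral>x. directional h G (x + t *\<^sub>R h) * box_bump n a c x \<partial>lborel)"
      by (simp only: e)
  qed
  finally show ?thesis .
qed

lemma directional_box_bound:
  assumes G: "G \<in> L2"
  shows "(\<integral>\<^sup>+x. ennreal (norm (indicator (box a c) x *\<^sub>R directional h G (x + v))) \<partial>lborel)
    \<le> ennreal ((norm h)\<^sup>2) * (\<integral>\<^sup>+x. ennreal (norm (G x) ^ 2) \<partial>lborel) + emeasure lborel (box a c)"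
proof -
  have [measurable]: "G \<in> borel_measurable borel" using G by (rule L2_measurable)
  have "(\<integral>\<^sup>+x. ennreal (norm (indicator (box a c) x *\<^sub>R directional h G (x + v))) \<partial>lborel)
      \<le> (\<integral>\<^sup>+x. ennreal (norm h * norm (G (x + v)) * indicator (box a c) x) \<partial>lborel)"
    by (intro nn_integral_mono ennreal_leI) (auto simp: indicator_def norm_directional_le)
  also have "\<dots> \<le> ennreal ((norm h)\<^sup>2) * (\<integral>\<^sup>+x. ennreal (norm (G (x + v)) ^ 2) \<partial>lborel) + emeasure lborel (box a c)"
    by (rule nn_integral_norm_indicator_le) auto
  also have "(\<integral>\<^sup>+x. ennreal (norm (G (x + v)) ^ 2) \<partial>lborel) = (\<integral>\<^sup>+x. ennreal (norm (G x) ^ 2) \<partial>lborel)"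
    by (rule nn_integral_translate) measurable
  finally show ?thesis .
qed

lemma directional_strip_measurable:
  assumes G: "G \<in> L2"
  shows "(\<lambda>(x, t). directional h G (x + t *\<^sub>R h)) \<in> borel_measurable (borel \<Otimes>\<^sub>M borel)"
proof -
  have [measurable]: "G \<in> borel_measurable borel" using G by (rule L2_measurable)
  show ?thesis by measurable
qed

text \<open>
  A weakly differentiable function satisfies the fundamental theorem of calculus on
  almost all parallel segments: by Fubini's theorem both sides have the same integral against every
  bump. The exceptional null set may depend on \<open>s\<close> and \<open>h\<close>.
\<close>

lemma difference_eq_line_integral:
  fixes u :: "real ^ 'd \<Rightarrow> complex"
  assumes u: "u \<in> L2" and G: "G \<in> L2" and w: "is_weak_gradient u G" and s: "0 \<le> s"
  shows "AE x in lborel. u (x + s *\<^sub>R h) - u x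
    = (\<integral>t. indicator {0..s} t *\<^sub>R directional h G (x + t *\<^sub>R h) \<partial>lborel)"
proof -
  have [measurable]: "u \<in> borel_measurable borel" "G \<in> borel_measurable borel"
    using u G by (auto intro: L2_measurable)
  define W where "W x = (\<integral>t. indicator {0..s} t *\<^sub>R directional h G (x + t *\<^sub>R h) \<partial>lborel)" for x
  note [measurable] = directional_strip_measurable[OF G]
  have W[measurable]: "W \<in> borel_measurable borel"
    unfolding W_def by measurable
  have bound_finite: "ennreal ((norm h)\<^sup>2) * (\<integral>\<^sup>+x. ennreal (norm (G x) ^ 2) \<partial>lborel) + emeasure lborel (box a c) < \<infinity>" for a c :: "real ^ 'd"
    using L2_finite[OF G] emeasure_box_finite by (auto simp: ennreal_mult_less_top)
  have Wint: "integrable lborel (\<lambda>x. indicator (box a c) x *\<^sub>R W x)" for a c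
  proof -
    have "(\<lambda>(x, t). indicator (box a c) x *\<^sub>R directional h G (x + t *\<^sub>R h)) \<in> borel_measurable (borel \<Otimes>\<^sub>M borel)"
      by measurable
    from lborel_pair.integrable_fst[OF fubini_strip(1)[OF this directional_box_bound[OF G] bound_finite]]
    have "integrable lborel (\<lambda>x. \<integral>t. indicator {0..s} t *\<^sub>R indicator (box a c) x *\<^sub>R directional h G (x + t *\<^sub>R h) \<partial>lborel)"
      by simp
    also have "(\<lambda>x. \<integral>t. indicator {0..s} t *\<^sub>R indicator (box a c) x *\<^sub>R directional h G (x + t *\<^sub>R h) \<partial>lborel)
        = (\<lambda>x. indicator (box a c) x *\<^sub>R W x)"
      unfolding W_def by (subst integral_scaleR_right[symmetric]) (simp only: scaleR_left_commute)
    finally show ?thesis .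
  qed
  have uint: "integrable lborel (\<lambda>x. u (x + v) * k x)"
    if [measurable]: "k \<in> borel_measurable borel" and "\<And>x. norm (k x) \<le> indicator (box a c) x" for v a c k
  proof (rule integrable_mult_bump[where B="box a c" and C=1])
    show "(\<integral>\<^sup>+x. ennreal (norm (u (x + v)) ^ 2) \<partial>lborel) < \<infinity>"
      using L2_finite[OF u] by (subst nn_integral_translate) auto
  qed (use that emeasure_box_finite in auto)
  have "AE x in lborel. u (x + s *\<^sub>R h) - u x - W x = 0"
  proof (rule AE_zero_if_bump_integrals_zero)
    fix a c :: "real ^ 'd"
    have "integrable lborel (\<lambda>x. u (x + v) * indicator (box a c) x)" for v
      by (rule uint[where a=a and c=c]) (auto simp: indicator_def)
    from this[of "s *\<^sub>R h"] this[of 0] Wint[of a c]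
    have "integrable lborel (\<lambda>x. u (x + s *\<^sub>R h) * indicator (box a c) x - u x * indicator (box a c) x
        - indicator (box a c) x *\<^sub>R W x)"
      by (intro Bochner_Integration.integrable_diff) auto
    then show "integrable lborel (\<lambda>x. indicator (box a c) x *\<^sub>R (u (x + s *\<^sub>R h) - u x - W x))"
      by (rule Bochner_Integration.integrable_cong[THEN iffD1, rotated -1]) (auto simp: indicator_def)
    fix n
    let ?\<psi> = "box_bump n a c"
    have i1: "integrable lborel (\<lambda>x. u (x + v) * ?\<psi> x)" for v
      by (rule uint[where a=a and c=c]) (auto simp: norm_box_bump_le)
    have i3: "integrable lborel (\<lambda>x. W x * ?\<psi> x)"
    proof (rule Bochner_Integration.integrable_bound[OF Wint[of a c]])
      show "AE x in lborel. norm (W x * ?\<psi> x) \<le> norm (indicator (box a c) x *\<^sub>R W x)"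
      proof (rule AE_I2)
        fix x
        show "norm (W x * ?\<psi> x) \<le> norm (indicator (box a c) x *\<^sub>R W x)"
          using mult_left_mono[OF norm_box_bump_le[of n a c x], of "norm (W x)"]
          by (simp add: norm_mult mult.commute)
      qed
    qed measurable
    have i2: "integrable lborel (\<lambda>x. u x * ?\<psi> (x - s *\<^sub>R h))"
    proof -
      have "integrable lborel (\<lambda>x. u (x + 0) * box_bump n (a + s *\<^sub>R h) (c + s *\<^sub>R h) x)"
        by (rule uint[where a="a + s *\<^sub>R h" and c="c + s *\<^sub>R h"]) (auto simp: norm_box_bump_le)
      then show ?thesis by (simp add: box_bump_shift)
    qed
    have "(\<integral>x. (u (x + s *\<^sub>R h) - u x - W x) * ?\<psi> x \<partial>lborel)
        = (\<integral>x. u (x + s *\<^sub>R h) * ?\<psi> x - u x * ?\<psi> x - W x * ?\<psi> x \<partial>lborel)"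
      by (simp add: left_diff_distrib)
    also have "\<dots> = (\<integral>x. u (x + s *\<^sub>R h) * ?\<psi> x \<partial>lborel) - (\<integral>x. u x * ?\<psi> x \<partial>lborel) - (\<integral>x. W x * ?\<psi> x \<partial>lborel)"
      using i1[of "s *\<^sub>R h"] i1[of 0] i3 by simp
    also have "(\<integral>x. u (x + s *\<^sub>R h) * ?\<psi> x \<partial>lborel) = (\<integral>x. u (x + s *\<^sub>R h) * ?\<psi> (x + s *\<^sub>R h - s *\<^sub>R h) \<partial>lborel)"
      by simp
    also have "\<dots> = (\<integral>x. u x * ?\<psi> (x - s *\<^sub>R h) \<partial>lborel)"
      by (rule integral_translate) measurable
    also have "(\<integral>x. u x * ?\<psi> (x - s *\<^sub>R h) \<partial>lborel) - (\<integral>x. u x * ?\<psi> x \<partial>lborel)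
        = (\<integral>x. u x * (?\<psi> (x - s *\<^sub>R h) - ?\<psi> x) \<partial>lborel)"
      using i2 i1[of 0] by (simp add: right_diff_distrib)
    also have "\<dots> = (\<integral>t. indicator {0..s} t *\<^sub>R (\<integral>x. directional h G (x + t *\<^sub>R h) * ?\<psi> x \<partial>lborel) \<partial>lborel)"
      by (rule bump_difference[OF u G w s])
    also have "\<dots> = (\<integral>x. (\<integral>t. indicator {0..s} t *\<^sub>R (directional h G (x + t *\<^sub>R h) * ?\<psi> x) \<partial>lborel) \<partial>lborel)"
    proof (rule fubini_strip(2)[symmetric, OF _ _ bound_finite[of a c]])
      show "(\<lambda>(x, t). directional h G (x + t *\<^sub>R h) * ?\<psi> x) \<in> borel_measurable (borel \<Otimes>\<^sub>M borel)"
        by measurable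
      fix t
      have "(\<integral>\<^sup>+x. ennreal (norm (directional h G (x + t *\<^sub>R h) * ?\<psi> x)) \<partial>lborel)
          \<le> (\<integral>\<^sup>+x. ennreal (norm (indicator (box a c) x *\<^sub>R directional h G (x + t *\<^sub>R h))) \<partial>lborel)"
      proof (intro nn_integral_mono ennreal_leI)
        fix x
        show "norm (directional h G (x + t *\<^sub>R h) * ?\<psi> x) \<le> norm (indicator (box a c) x *\<^sub>R directional h G (x + t *\<^sub>R h))"
          using mult_left_mono[OF norm_box_bump_le[of n a c x], of "norm (directional h G (x + t *\<^sub>R h))"]
          by (simp add: norm_mult mult.commute)
      qed
      also note directional_box_bound[OF G]
      finally show "(\<integral>\<^sup>+x. ennreal (norm (directional h G (x + t *\<^sub>R h) * ?\<psi> x)) \<partial>lborel)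
        \<le> ennreal ((norm h)\<^sup>2) * (\<integral>\<^sup>+x. ennreal (norm (G x) ^ 2) \<partial>lborel) + emeasure lborel (box a c)" .
    qed
    also have "\<dots> = (\<integral>x. W x * ?\<psi> x \<partial>lborel)"
    proof (rule Bochner_Integration.integral_cong[OF refl])
      fix x
      show "(\<integral>t. indicator {0..s} t *\<^sub>R (directional h G (x + t *\<^sub>R h) * ?\<psi> x) \<partial>lborel) = W x * ?\<psi> x"
        unfolding W_def by (subst integral_mult_left_zero[symmetric]) (simp only: mult_scaleR_left)
    qed
    finally show "(\<integral>x. (u (x + s *\<^sub>R h) - u x - W x) * ?\<psi> x \<partial>lborel) = 0" by simp
  qed measurable
  then show ?thesis unfolding W_def by (rule AE_mp) (intro AE_I2 impI, simp)
qed

section \<open>Truncation and level sets\<close>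

text \<open>
  The interval runs from the last time at which the value is at most \<open>A\<close> to the first time after it
  at which the value is at least \<open>B\<close>.
\<close>

lemma crossing_interval_up:
  fixes V :: "real \<Rightarrow> real"
  assumes V: "continuous_on {0..1} V" and "A < B" "V 0 \<le> A" "B \<le> V 1"
  shows "\<exists>s t. 0 \<le> s \<and> s < t \<and> t \<le> 1 \<and> B - A \<le> \<bar>V t - V s\<bar> \<and> (\<forall>\<tau>\<in>{s<..<t}. A < V \<tau> \<and> V \<tau> < B)"
proof -
  let ?S = "{0..1} \<inter> V -` {..A}"
  have "0 \<in> ?S" using assms by simp
  then have "?S \<noteq> {}" by blast
  then have S: "closed ?S" "?S \<noteq> {}" "bdd_above ?S"
    using continuous_closed_preimage[OF V closed_atLeastAtMost closed_atMost[of A]]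
      bdd_above_mono[OF bdd_above_Icc, of "{0..1} \<inter> V -` {..A}" 0 1, OF Int_lower1] by blast+
  define s where "s = Sup ?S"
  have s: "s \<in> ?S" unfolding s_def using S by (intro closed_contains_Sup)
  have s_max: "\<tau> \<le> s" if "\<tau> \<in> ?S" for \<tau> unfolding s_def using that S(3) by (rule cSup_upper)
  let ?T = "{s..1} \<inter> V -` {B..}"
  have Vs: "continuous_on {s..1} V" using V s by (auto intro: continuous_on_subset)
  have "1 \<in> ?T" using assms s by simp
  then have "?T \<noteq> {}" by blast
  then have T: "closed ?T" "?T \<noteq> {}" "bdd_below ?T"
    using continuous_closed_preimage[OF Vs closed_atLeastAtMost closed_atLeast[of B]]
      bdd_below_mono[OF bdd_below_Icc, of "{s..1} \<inter> V -` {B..}" s 1, OF Int_lower1] by blast+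
  define t where "t = Inf ?T"
  have t: "t \<in> ?T" unfolding t_def using T by (intro closed_contains_Inf)
  have t_min: "t \<le> \<tau>" if "\<tau> \<in> ?T" for \<tau> unfolding t_def using that T(3) by (rule cInf_lower)
  have "s \<noteq> t" using s t \<open>A < B\<close> by auto
  moreover have "A < V \<tau> \<and> V \<tau> < B" if "\<tau> \<in> {s<..<t}" for \<tau>
    using that s_max[of \<tau>] t_min[of \<tau>] s t by fastforce
  ultimately show ?thesis using s t \<open>A < B\<close>
    by (intro exI[of _ s] exI[of _ t]) auto
qed

lemma crossing_interval:
  fixes V :: "real \<Rightarrow> real"
  assumes V: "continuous_on {0..1} V" and AB: "A < B"
    and cases: "V 0 \<le> A \<and> B \<le> V 1 \<or> V 1 \<le> A \<and> B \<le> V 0"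
  shows "\<exists>s t. 0 \<le> s \<and> s < t \<and> t \<le> 1 \<and> B - A \<le> \<bar>V t - V s\<bar> \<and> (\<forall>\<tau>\<in>{s<..<t}. A < V \<tau> \<and> V \<tau> < B)"
  using cases
proof
  assume "V 0 \<le> A \<and> B \<le> V 1"
  then show ?thesis using crossing_interval_up[OF V AB] by blast
next
  assume "V 1 \<le> A \<and> B \<le> V 0"
  then have "\<exists>s t. 0 \<le> s \<and> s < t \<and> t \<le> 1 \<and> - A - - B \<le> \<bar>- V t - - V s\<bar>
      \<and> (\<forall>\<tau>\<in>{s<..<t}. - B < - V \<tau> \<and> - V \<tau> < - A)"
    using AB by (intro crossing_interval_up continuous_on_minus V) auto
  then obtain s t where "0 \<le> s" "s < t" "t \<le> 1" "- A - - B \<le> \<bar>- V t - - V s\<bar>"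
    "\<forall>\<tau>\<in>{s<..<t}. - B < - V \<tau> \<and> - V \<tau> < - A" by blast
  then show ?thesis by (intro exI[of _ s] exI[of _ t]) auto
qed

abbreviation band :: "real \<Rightarrow> real set" where
  "band l \<equiv> {z. l < z \<and> z \<le> 2 * l}"

definition clip :: "real \<Rightarrow> real \<Rightarrow> real" where
  "clip l z = min (max z l) (2 * l)"

lemma clip_measurable [measurable]: "clip l \<in> borel_measurable borel"
  unfolding clip_def[abs_def] by measurable

lemma clip_range: "0 < l \<Longrightarrow> l \<le> clip l z \<and> clip l z \<le> 2 * l"
  by (simp add: clip_def)

lemma le_clip: "clip l z < 2 * l \<Longrightarrow> z \<le> clip l z"
  by (auto simp: clip_def)

lemma clip_le: "l < clip l z \<Longrightarrow> clip l z \<le> z"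
  by (auto simp: clip_def)

text \<open>
  To change the truncated modulus, the path has to cross from one truncated value to the other, and it
  does so on an interval on which the modulus stays inside the band. Hence only the speed of the path
  inside the band counts. This replaces a chain rule for truncations.
\<close>

lemma clip_path_le:
  fixes g :: "real \<Rightarrow> complex"
  assumes l: "0 < l"
    and g: "integrable lborel (\<lambda>t. indicator {0..1} t *\<^sub>R g t)"
    and gm [measurable]: "g \<in> borel_measurable borel"
    and U: "\<And>s. s \<in> {0..1} \<Longrightarrow> U s = U0 + (\<integral>t. indicator {0..s} t *\<^sub>R g t \<partial>lborel)"
  shows "ennreal \<bar>clip l (norm (U 1)) - clip l (norm (U 0))\<bar>
    \<le> (\<integral>\<^sup>+t. indicator {0..1} t * (ennreal (norm (g t)) * indicator (band l) (norm (U t))) \<partial>lborel)"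
proof (cases "clip l (norm (U 1)) = clip l (norm (U 0))")
  case False
  define V where "V t = norm (U t)" for t
  define A where "A = min (clip l (V 0)) (clip l (V 1))"
  define B where "B = max (clip l (V 0)) (clip l (V 1))"
  have sub: "integrable lborel (\<lambda>t. indicator {a..b} t *\<^sub>R g t)" if "0 \<le> a" "b \<le> 1" for a b
  proof -
    have "set_integrable lborel {0..1} g" using g by (simp add: set_integrable_def)
    from set_integrable_subset[OF this, of "{a..b}"] that have "set_integrable lborel {a..b} g"
      by simp
    then show ?thesis by (simp add: set_integrable_def)
  qed
  have "continuous_on {0..1} U"
  proof -
    have "g integrable_on {0..1}"
      using set_borel_integral_eq_integral(1)[of "{0..1}" g] g by (simp add: set_integrable_def)
    then have "continuous_on {0..1} (\<lambda>s. U0 + integral {0..s} g)"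
      by (intro continuous_on_add continuous_on_const indefinite_integral_continuous_1)
    moreover have "U s = U0 + integral {0..s} g" if "s \<in> {0..1}" for s
    proof -
      have "set_integrable lborel {0..s} g"
        using sub[of 0 s] that by (simp add: set_integrable_def)
      from set_borel_integral_eq_integral(2)[OF this] U[OF that] show ?thesis
        by (simp only: set_lebesgue_integral_def)
    qed
    ultimately show ?thesis by (subst continuous_on_cong[OF refl])
  qed
  then have "continuous_on {0..1} V" unfolding V_def by (rule continuous_on_norm)
  moreover have AB: "A < B" using False unfolding A_def B_def V_def by linarith
  moreover have lA: "l \<le> A" "B \<le> 2 * l"
    unfolding A_def B_def using clip_range[OF l] by auto
  moreover have "V 0 \<le> A \<and> B \<le> V 1 \<or> V 1 \<le> A \<and> B \<le> V 0"
  proof (cases "clip l (V 0) < clip l (V 1)")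
    case True
    then have "A = clip l (V 0)" "B = clip l (V 1)" by (auto simp: A_def B_def)
    then show ?thesis using le_clip[of l "V 0"] clip_le[of l "V 1"] AB lA by auto
  next
    case False
    then have "A = clip l (V 1)" "B = clip l (V 0)" by (auto simp: A_def B_def)
    then show ?thesis using le_clip[of l "V 1"] clip_le[of l "V 0"] AB lA by auto
  qed
  ultimately obtain s t where st: "0 \<le> s" "s < t" "t \<le> 1" "B - A \<le> \<bar>V t - V s\<bar>"
    "\<forall>\<tau>\<in>{s<..<t}. A < V \<tau> \<and> V \<tau> < B" using crossing_interval by blast
  have i0t: "integrable lborel (\<lambda>\<tau>. indicator {0..t} \<tau> *\<^sub>R g \<tau>)"
    and i0s: "integrable lborel (\<lambda>\<tau>. indicator {0..s} \<tau> *\<^sub>R g \<tau>)"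
    using sub[of 0 t] sub[of 0 s] st(1-3) by simp_all
  have "\<bar>clip l (norm (U 1)) - clip l (norm (U 0))\<bar> = B - A"
    unfolding A_def B_def V_def by linarith
  also have "\<dots> \<le> \<bar>V t - V s\<bar>" by (rule st)
  also have "\<dots> \<le> norm (U t - U s)" unfolding V_def by (rule norm_triangle_ineq3)
  also have "U t - U s = (\<integral>\<tau>. indicator {0..t} \<tau> *\<^sub>R g \<tau> \<partial>lborel) - (\<integral>\<tau>. indicator {0..s} \<tau> *\<^sub>R g \<tau> \<partial>lborel)"
    using U[of s] U[of t] st(1-3) by simp
  also have "\<dots> = (\<integral>\<tau>. indicator {0..t} \<tau> *\<^sub>R g \<tau> - indicator {0..s} \<tau> *\<^sub>R g \<tau> \<partial>lborel)"
    by (rule Bochner_Integration.integral_diff[symmetric]) (rule i0t i0s)+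
  finally have "ennreal \<bar>clip l (norm (U 1)) - clip l (norm (U 0))\<bar>
      \<le> ennreal (norm (\<integral>\<tau>. indicator {0..t} \<tau> *\<^sub>R g \<tau> - indicator {0..s} \<tau> *\<^sub>R g \<tau> \<partial>lborel))"
    by (rule ennreal_leI)
  also have "\<dots> \<le> (\<integral>\<^sup>+\<tau>. ennreal (norm (indicator {0..t} \<tau> *\<^sub>R g \<tau> - indicator {0..s} \<tau> *\<^sub>R g \<tau>)) \<partial>lborel)"
    by (rule integral_norm_bound_ennreal) (rule Bochner_Integration.integrable_diff[OF i0t i0s])
  also have "\<dots> \<le> (\<integral>\<^sup>+t. indicator {0..1} t * (ennreal (norm (g t)) * indicator (band l) (norm (U t))) \<partial>lborel)"
  proof (rule nn_integral_mono_AE, rule AE_mp[OF AE_lborel_singleton[of t]], intro AE_I2 impI)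
    fix \<tau> assume "\<tau> \<noteq> t"
    show "ennreal (norm (indicator {0..t} \<tau> *\<^sub>R g \<tau> - indicator {0..s} \<tau> *\<^sub>R g \<tau>))
      \<le> indicator {0..1} \<tau> * (ennreal (norm (g \<tau>)) * indicator (band l) (norm (U \<tau>)))"
    proof (cases "\<tau> \<in> {s<..<t}")
      case True
      then have "A < norm (U \<tau>) \<and> norm (U \<tau>) < B" using st(5) by (simp add: V_def)
      then show ?thesis using True st(1-3) lA by (simp add: indicator_def)
    next
      case False
      then have "indicator {0..t} \<tau> *\<^sub>R g \<tau> - indicator {0..s} \<tau> *\<^sub>R g \<tau> = 0"
        using \<open>\<tau> \<noteq> t\<close> st(1-3) by (auto simp: indicator_def)
      then show ?thesis by (simp only: norm_zero ennreal_0 zero_le)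
    qed
  qed
  finally show ?thesis .
qed simp

lemma nn_integral_directional_strip:
  fixes G :: "real ^ 'd \<Rightarrow> complex ^ 'd"
  assumes [measurable]: "G \<in> borel_measurable borel" "S \<in> sets borel"
  shows "(\<integral>\<^sup>+x. (\<integral>\<^sup>+t. indicator {0..1} t * (ennreal ((norm h * norm (G (x + t *\<^sub>R h)))\<^sup>2) * indicator S (x + t *\<^sub>R h)) \<partial>lborel) \<partial>lborel)
    = ennreal ((norm h)\<^sup>2) * (\<integral>\<^sup>+x. ennreal (norm (G x) ^ 2) * indicator S x \<partial>lborel)"
proof -
  have "(\<integral>\<^sup>+x. (\<integral>\<^sup>+t. indicator {0..1} t * (ennreal ((norm h * norm (G (x + t *\<^sub>R h)))\<^sup>2) * indicator S (x + t *\<^sub>R h)) \<partial>lborel) \<partial>lborel)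
    = (\<integral>\<^sup>+t. (\<integral>\<^sup>+x. indicator {0..1} t * (ennreal ((norm h * norm (G (x + t *\<^sub>R h)))\<^sup>2) * indicator S (x + t *\<^sub>R h)) \<partial>lborel) \<partial>lborel)"
    by (rule lborel_pair.Fubini') measurable
  also have "\<dots> = (\<integral>\<^sup>+t. (\<integral>\<^sup>+x. ennreal ((norm h * norm (G x))\<^sup>2) * indicator S x \<partial>lborel) * indicator {0..1::real} t \<partial>lborel)"
  proof (rule nn_integral_cong)
    fix t :: real
    have "(\<integral>\<^sup>+x. indicator {0..1} t * (ennreal ((norm h * norm (G (x + t *\<^sub>R h)))\<^sup>2) * indicator S (x + t *\<^sub>R h)) \<partial>lborel)
      = indicator {0..1} t * (\<integral>\<^sup>+x. ennreal ((norm h * norm (G (x + t *\<^sub>R h)))\<^sup>2) * indicator S (x + t *\<^sub>R h) \<partial>lborel)"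
      by (rule nn_integral_cmult) measurable
    also have "(\<integral>\<^sup>+x. ennreal ((norm h * norm (G (x + t *\<^sub>R h)))\<^sup>2) * indicator S (x + t *\<^sub>R h) \<partial>lborel)
      = (\<integral>\<^sup>+x. ennreal ((norm h * norm (G x))\<^sup>2) * indicator S x \<partial>lborel)"
      by (rule nn_integral_translate) measurable
    finally show "(\<integral>\<^sup>+x. indicator {0..1} t * (ennreal ((norm h * norm (G (x + t *\<^sub>R h)))\<^sup>2) * indicator S (x + t *\<^sub>R h)) \<partial>lborel)
      = (\<integral>\<^sup>+x. ennreal ((norm h * norm (G x))\<^sup>2) * indicator S x \<partial>lborel) * indicator {0..1} t"
      by (simp add: mult.commute)
  qed
  also have "\<dots> = (\<integral>\<^sup>+x. ennreal ((norm h * norm (G x))\<^sup>2) * indicator S x \<partial>lborel)"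
    by (subst nn_integral_cmult_indicator) auto
  also have "\<dots> = (\<integral>\<^sup>+x. ennreal ((norm h)\<^sup>2) * (ennreal (norm (G x) ^ 2) * indicator S x) \<partial>lborel)"
    by (simp add: power_mult_distrib ennreal_mult mult.assoc)
  also have "\<dots> = ennreal ((norm h)\<^sup>2) * (\<integral>\<^sup>+x. ennreal (norm (G x) ^ 2) * indicator S x \<partial>lborel)"
    by (rule nn_integral_cmult) measurable
  finally show ?thesis .
qed

lemma line_integral_measurable:
  assumes G: "G \<in> L2"
  shows "(\<lambda>(x, s). \<integral>t. indicator {0..s} t *\<^sub>R directional h G (x + t *\<^sub>R h) \<partial>lborel)
    \<in> borel_measurable (borel \<Otimes>\<^sub>M borel)"
proof -
  note [measurable] = directional_strip_measurable[OF G]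
  have "(\<lambda>(x, s). \<integral>t. (if 0 \<le> t \<and> t \<le> s then 1 else 0) *\<^sub>R directional h G (x + t *\<^sub>R h) \<partial>lborel)
    \<in> borel_measurable (borel \<Otimes>\<^sub>M borel)"
    by measurable
  then show ?thesis by (simp add: indicator_def of_bool_def)
qed

lemma le_one_plus_square:
  fixes z :: real assumes "0 \<le> z" shows "z \<le> 1 + z\<^sup>2"
  using zero_le_power2[of "z - 1"] assms by (simp add: power2_diff)

text \<open>
  For almost every \<open>x\<close> the line integral is an absolutely continuous path that agrees with \<open>u\<close> at
  almost all points of the segment and at its two end points. The bound for paths applies to it, and
  the band condition can be read off \<open>u\<close> itself.
\<close>

lemma clip_difference_le:
  fixes u :: "real ^ 'd \<Rightarrow> complex"
  assumes u: "u \<in> L2" and G: "G \<in> L2" and w: "is_weak_gradient u G" and l: "0 < l"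
  shows "AE x in lborel. ennreal \<bar>clip l (norm (u (x + h))) - clip l (norm (u x))\<bar>
    \<le> (\<integral>\<^sup>+t. indicator {0..1} t * (ennreal (norm h * norm (G (x + t *\<^sub>R h)))
          * indicator {y. norm (u y) \<in> band l} (x + t *\<^sub>R h)) \<partial>lborel)"
proof -
  have [measurable]: "u \<in> borel_measurable borel" "G \<in> borel_measurable borel"
    using u G by (auto intro: L2_measurable)
  define W where "W x s = (\<integral>t. indicator {0..s} t *\<^sub>R directional h G (x + t *\<^sub>R h) \<partial>lborel)" for x s
  have Wm[measurable]: "(\<lambda>(x, s). W x s) \<in> borel_measurable (borel \<Otimes>\<^sub>M borel)"
    unfolding W_def by (rule line_integral_measurable[OF G])
  define P where "P x s \<longleftrightarrow> (0 \<le> s \<longrightarrow> u (x + s *\<^sub>R h) - u x = W x s)" for x s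
  have P: "AE x in lborel. P x s" for s
    using difference_eq_line_integral[OF u G w, of s h]
    by (cases "0 \<le> s") (auto simp: P_def W_def)
  \<comment> \<open>Exchanging the quantifiers removes the dependence of the null set on \<open>s\<close>.\<close>
  have "AE x in lborel. AE s in lborel. P x s"
  proof (subst lborel_pair.AE_commute)
    show "{z \<in> space (lborel \<Otimes>\<^sub>M lborel). P (fst z) (snd z)} \<in> sets (lborel \<Otimes>\<^sub>M lborel)"
      unfolding P_def by measurable
    show "AE s in lborel. AE x in lborel. P x s" using P by simp
  qed
  moreover have "AE x in lborel. P x 1" by (rule P)
  moreover have "AE x in lborel. (\<integral>\<^sup>+t. indicator {0..1} t * (ennreal ((norm h * norm (G (x + t *\<^sub>R h)))\<^sup>2) * indicator UNIV (x + t *\<^sub>R h)) \<partial>lborel) \<noteq> \<infinity>"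
  proof (rule nn_integral_noteq_infinite)
    show "(\<integral>\<^sup>+x. (\<integral>\<^sup>+t. indicator {0..1} t * (ennreal ((norm h * norm (G (x + t *\<^sub>R h)))\<^sup>2) * indicator UNIV (x + t *\<^sub>R h)) \<partial>lborel) \<partial>lborel) \<noteq> \<infinity>"
      using L2_finite[OF G] by (subst nn_integral_directional_strip) (auto simp: ennreal_mult_eq_top_iff)
  qed measurable
  ultimately show ?thesis
  proof eventually_elim
    case (elim x)
    define g where "g t = directional h G (x + t *\<^sub>R h)" for t
    have gm[measurable]: "g \<in> borel_measurable borel" unfolding g_def by measurable
    have gi: "integrable lborel (\<lambda>t. indicator {0..1} t *\<^sub>R g t)"
    proof (rule integrableI_bounded)
      have "(\<integral>\<^sup>+t. ennreal (norm (indicator {0..1} t *\<^sub>R g t)) \<partial>lborel)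
        \<le> (\<integral>\<^sup>+t. indicator {0..1} t + indicator {0..1} t * (ennreal ((norm h * norm (G (x + t *\<^sub>R h)))\<^sup>2) * indicator UNIV (x + t *\<^sub>R h)) \<partial>lborel)"
      proof (rule nn_integral_mono)
        fix t :: real
        let ?z = "norm h * norm (G (x + t *\<^sub>R h))"
        have "norm (g t) \<le> ?z" unfolding g_def by (rule norm_directional_le)
        also have "\<dots> \<le> 1 + ?z\<^sup>2" by (rule le_one_plus_square) simp
        finally have "ennreal (norm (g t)) \<le> 1 + ennreal (?z\<^sup>2)"
          using ennreal_leI ennreal_plus[of 1 "?z\<^sup>2"] by fastforce
        then show "ennreal (norm (indicator {0..1} t *\<^sub>R g t))
          \<le> indicator {0..1} t + indicator {0..1} t * (ennreal (?z\<^sup>2) * indicator UNIV (x + t *\<^sub>R h))"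
          by (simp add: indicator_def)
      qed
      also have "\<dots> = 1 + (\<integral>\<^sup>+t. indicator {0..1} t * (ennreal ((norm h * norm (G (x + t *\<^sub>R h)))\<^sup>2) * indicator UNIV (x + t *\<^sub>R h)) \<partial>lborel)"
        by (subst nn_integral_add) auto
      also have "\<dots> < \<infinity>" using elim(3) by (simp add: less_top)
      finally show "(\<integral>\<^sup>+t. ennreal (norm (indicator {0..1} t *\<^sub>R g t)) \<partial>lborel) < \<infinity>" .
    qed measurable
    define U where "U s = u x + W x s" for s
    have U0: "U 0 = u x"
    proof -
      have "AE t in lborel. indicator {0..0} t *\<^sub>R directional h G (x + t *\<^sub>R h) = 0"
        using AE_lborel_singleton[of "0::real"] by (rule eventually_mono) simp
      then have "W x 0 = 0"
        unfolding W_def by (rule integral_eq_zero_AE)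
      then show ?thesis by (simp add: U_def)
    qed
    have U1: "U 1 = u (x + h)" using elim(2) by (simp add: U_def P_def algebra_simps)
    have "ennreal \<bar>clip l (norm (U 1)) - clip l (norm (U 0))\<bar>
      \<le> (\<integral>\<^sup>+t. indicator {0..1} t * (ennreal (norm (g t)) * indicator (band l) (norm (U t))) \<partial>lborel)"
      by (rule clip_path_le[OF l gi gm, of U "u x"]) (simp add: U_def W_def g_def)
    also have "\<dots> \<le> (\<integral>\<^sup>+t. indicator {0..1} t * (ennreal (norm h * norm (G (x + t *\<^sub>R h)))
          * indicator {y. norm (u y) \<in> band l} (x + t *\<^sub>R h)) \<partial>lborel)"
    proof (rule nn_integral_mono_AE, rule AE_mp[OF elim(1)], intro AE_I2 impI)
      fix t assume "P x t"
      then have "U t = u (x + t *\<^sub>R h)" if "t \<in> {0..1}" using that by (simp add: P_def U_def algebra_simps)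
      then show "indicator {0..1} t * (ennreal (norm (g t)) * indicator (band l) (norm (U t)))
        \<le> indicator {0..1} t * (ennreal (norm h * norm (G (x + t *\<^sub>R h)))
          * indicator {y. norm (u y) \<in> band l} (x + t *\<^sub>R h))"
        using norm_directional_le[of h G "x + t *\<^sub>R h"]
        by (auto simp: indicator_def g_def intro!: ennreal_leI)
    qed
    finally show ?case unfolding U0 U1 .
  qed
qed

definition band_energy :: "(real ^ 'd \<Rightarrow> complex) \<Rightarrow> (real ^ 'd \<Rightarrow> complex ^ 'd) \<Rightarrow> real \<Rightarrow> ennreal" where
  "band_energy u G l = (\<integral>\<^sup>+x. ennreal (norm (G x) ^ 2) * indicator {y. norm (u y) \<in> band l} x \<partial>lborel)"

text \<open>
  Cauchy-Schwarz on the unit segment, followed by Tonelli's theorem and translation invariance.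
\<close>

lemma clip_translation_L2:
  fixes u :: "real ^ 'd \<Rightarrow> complex"
  assumes u: "u \<in> L2" and G: "G \<in> L2" and w: "is_weak_gradient u G" and l: "0 < l"
  shows "(\<integral>\<^sup>+x. ennreal ((clip l (norm (u (x + h))) - clip l (norm (u x)))\<^sup>2) \<partial>lborel)
    \<le> ennreal ((norm h)\<^sup>2) * band_energy u G l"
proof -
  have [measurable]: "u \<in> borel_measurable borel" "G \<in> borel_measurable borel"
    using u G by (auto intro: L2_measurable)
  let ?S = "{y. norm (u y) \<in> band l}"
  have [measurable]: "?S \<in> sets borel" by measurable
  have "(\<integral>\<^sup>+x. ennreal ((clip l (norm (u (x + h))) - clip l (norm (u x)))\<^sup>2) \<partial>lborel)
    \<le> (\<integral>\<^sup>+x. (\<integral>\<^sup>+t. indicator {0..1} t * (ennreal ((norm h * norm (G (x + t *\<^sub>R h)))\<^sup>2) * indicator ?S (x + t *\<^sub>R h)) \<partial>lborel) \<partial>lborel)"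
  proof (rule nn_integral_mono_AE, rule AE_mp[OF clip_difference_le[OF u G w l, of h]], intro AE_I2 impI)
    fix x
    let ?F = "\<lambda>t. ennreal (norm h * norm (G (x + t *\<^sub>R h))) * indicator ?S (x + t *\<^sub>R h)"
    assume *: "ennreal \<bar>clip l (norm (u (x + h))) - clip l (norm (u x))\<bar> \<le> (\<integral>\<^sup>+t. indicator {0..1} t * ?F t \<partial>lborel)"
    have "ennreal ((clip l (norm (u (x + h))) - clip l (norm (u x)))\<^sup>2)
      = (ennreal \<bar>clip l (norm (u (x + h))) - clip l (norm (u x))\<bar>)\<^sup>2"
      by (simp add: ennreal_power)
    also have "\<dots> \<le> (\<integral>\<^sup>+t. indicator {0..1} t * ?F t \<partial>lborel)\<^sup>2" by (rule power_mono[OF *]) simp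
    also have "(\<integral>\<^sup>+t. indicator {0..1} t * ?F t \<partial>lborel) = (\<integral>\<^sup>+t. indicator {0..1} t * (indicator {0..1} t * ?F t) \<partial>lborel)"
      by (intro nn_integral_cong) (simp add: indicator_def)
    also have "(\<integral>\<^sup>+t. indicator {0..1} t * (indicator {0..1} t * ?F t) \<partial>lborel)\<^sup>2
      \<le> (\<integral>\<^sup>+t. (indicator {0..1::real} t)\<^sup>2 \<partial>lborel) * (\<integral>\<^sup>+t. (indicator {0..1} t * ?F t)\<^sup>2 \<partial>lborel)"
      by (rule Cauchy_Schwarz_nn_integral) measurable
    also have "(\<integral>\<^sup>+t. (indicator {0..1::real} t)\<^sup>2 \<partial>lborel) = (\<integral>\<^sup>+t. indicator {0..1::real} t \<partial>lborel)"
      by (intro nn_integral_cong) (simp add: indicator_def)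
    also have "\<dots> = 1" by simp
    also have "(\<integral>\<^sup>+t. (indicator {0..1} t * ?F t)\<^sup>2 \<partial>lborel)
      = (\<integral>\<^sup>+t. indicator {0..1} t * (ennreal ((norm h * norm (G (x + t *\<^sub>R h)))\<^sup>2) * indicator ?S (x + t *\<^sub>R h)) \<partial>lborel)"
      by (intro nn_integral_cong) (simp add: indicator_def ennreal_power)
    finally show "ennreal ((clip l (norm (u (x + h))) - clip l (norm (u x)))\<^sup>2)
      \<le> (\<integral>\<^sup>+t. indicator {0..1} t * (ennreal ((norm h * norm (G (x + t *\<^sub>R h)))\<^sup>2) * indicator ?S (x + t *\<^sub>R h)) \<partial>lborel)"
      by simp
  qed
  also have "\<dots> = ennreal ((norm h)\<^sup>2) * band_energy u G l"
    unfolding band_energy_def by (rule nn_integral_directional_strip) measurable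
  finally show ?thesis .
qed

text \<open>
  Let $|u(x)| > 2l$, and let \<open>h\<close> range over a cube of side \<open>r\<close>. Since the cube has at least twice the
  measure of $\{|u| > l\}$, for at least half of the \<open>h\<close> one has $|u(x + h)| \le l$, and the truncated
  modulus drops by \<open>l\<close> between \<open>x\<close> and \<open>x + h\<close>. Averaging over the cube compares the
  measure of $\{|u| > 2l\}$ with translation differences, where $|h|^2 \le d\,r^2$.
\<close>

lemma level_set_step_ennreal:
  fixes u :: "real ^ 'd \<Rightarrow> complex"
  assumes u: "u \<in> L2" and G: "G \<in> L2" and w: "is_weak_gradient u G"
    and l: "0 < l" and r: "0 < r"
    and small: "2 * emeasure lborel {x. l < norm (u x)} \<le> ennreal (r ^ CARD('d))"
  shows "ennreal (l\<^sup>2) * emeasure lborel {x. 2 * l < norm (u x)}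
    \<le> ennreal (2 * real CARD('d) * r\<^sup>2) * band_energy u G l"
proof -
  have [measurable]: "u \<in> borel_measurable borel" "G \<in> borel_measurable borel"
    using u G by (auto intro: L2_measurable)
  define Q where "Q = cbox (0 :: real ^ 'd) (\<chi> i. r)"
  have [measurable]: "Q \<in> sets borel" by (simp add: Q_def)
  have Qne: "Q \<noteq> {}" unfolding Q_def by (rule ccontr) (use r in \<open>auto simp: interval_eq_empty_cart\<close>)
  have Q: "emeasure lborel Q = ennreal (r ^ CARD('d))"
  proof -
    have "measure lborel Q = (\<Prod>i\<in>(UNIV :: 'd set). r)"
      using content_cbox_cart[of "0 :: real ^ 'd" "\<chi> i. r"] Qne by (simp add: Q_def)
    then show ?thesis
      using emeasure_eq_ennreal_measure[of lborel Q] emeasure_cbox_finite[of "0 :: real ^ 'd" "\<chi> i. r"]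
      by (simp add: Q_def less_top)
  qed
  define R where "R = ennreal (r ^ CARD('d))"
  have R: "R \<noteq> 0" "R \<noteq> top" using r by (auto simp: R_def)
  define D where "D x h = ennreal ((clip l (norm (u (x + h))) - clip l (norm (u x)))\<^sup>2)" for x h
  have Dm[measurable]: "(\<lambda>(x, h). D x h) \<in> borel_measurable (borel \<Otimes>\<^sub>M borel)"
    unfolding D_def by measurable
  have pt: "R * (ennreal (l\<^sup>2) * indicator {x. 2 * l < norm (u x)} x) \<le> 2 * (\<integral>\<^sup>+h. indicator Q h * D x h \<partial>lborel)" for x
  proof (cases "2 * l < norm (u x)")
    case True
    let ?L = "{h \<in> Q. norm (u (x + h)) \<le> l}" and ?H = "{h. l < norm (u (x + h))}"
    have [measurable]: "?L \<in> sets borel" "?H \<in> sets borel" by measurable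
    have "R \<le> emeasure lborel (?L \<union> ?H)"
      unfolding R_def Q[symmetric] by (intro emeasure_mono) auto
    also have "\<dots> \<le> emeasure lborel ?L + emeasure lborel ?H" by (rule emeasure_subadditive) auto
    also have "emeasure lborel ?H = (\<integral>\<^sup>+h. indicator {y. l < norm (u y)} (h + x) \<partial>lborel)"
      using nn_integral_indicator[of ?H lborel] by (simp add: indicator_def add.commute)
    also have "\<dots> = emeasure lborel {y. l < norm (u y)}" by (subst nn_integral_translate) auto
    finally have "R \<le> emeasure lborel ?L + emeasure lborel {y. l < norm (u y)}" .
    from mult_left_mono[OF this, of 2]
    have "2 * R \<le> 2 * emeasure lborel ?L + 2 * emeasure lborel {y. l < norm (u y)}"
      by (simp add: distrib_left)
    also have "\<dots> \<le> 2 * emeasure lborel ?L + R" using small by (intro add_mono) (auto simp: R_def)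
    finally have "R + R \<le> R + 2 * emeasure lborel ?L" by (simp add: mult_2 add.commute)
    then have "R \<le> 2 * emeasure lborel ?L" using R by (simp add: ennreal_add_left_cancel_le)
    then have "R * ennreal (l\<^sup>2) \<le> 2 * emeasure lborel ?L * ennreal (l\<^sup>2)" by (rule mult_right_mono) simp
    also have "\<dots> = 2 * (\<integral>\<^sup>+h. ennreal (l\<^sup>2) * indicator ?L h \<partial>lborel)"
      by (subst nn_integral_cmult_indicator) (auto simp: mult_ac)
    also have "\<dots> \<le> 2 * (\<integral>\<^sup>+h. indicator Q h * D x h \<partial>lborel)"
    proof (intro mult_left_mono nn_integral_mono)
      fix h
      have "D x h = ennreal (l\<^sup>2)" if "norm (u (x + h)) \<le> l"
        using True that l by (simp add: D_def clip_def power2_commute)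
      then show "ennreal (l\<^sup>2) * indicator ?L h \<le> indicator Q h * D x h"
        by (auto simp: indicator_def)
    qed simp
    finally show ?thesis using True by simp
  qed simp
  have hQ: "(norm h)\<^sup>2 \<le> real CARD('d) * r\<^sup>2" if "h \<in> Q" for h
  proof -
    have "(norm h)\<^sup>2 = (\<Sum>i\<in>UNIV. (h $ i)\<^sup>2)"
      by (simp add: norm_vec_def L2_set_def sum_nonneg)
    also have "\<dots> \<le> (\<Sum>i\<in>(UNIV :: 'd set). r\<^sup>2)"
      using that by (intro sum_mono power_mono) (auto simp: Q_def mem_box_cart)
    finally show ?thesis by simp
  qed
  have "R * (ennreal (l\<^sup>2) * emeasure lborel {x. 2 * l < norm (u x)})
    = (\<integral>\<^sup>+x. R * (ennreal (l\<^sup>2) * indicator {x. 2 * l < norm (u x)} x) \<partial>lborel)"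
    by (subst nn_integral_cmult, measurable, subst nn_integral_cmult_indicator, measurable)
  also have "\<dots> \<le> (\<integral>\<^sup>+x. 2 * (\<integral>\<^sup>+h. indicator Q h * D x h \<partial>lborel) \<partial>lborel)"
    by (intro nn_integral_mono pt)
  also have "\<dots> = 2 * (\<integral>\<^sup>+x. (\<integral>\<^sup>+h. indicator Q h * D x h \<partial>lborel) \<partial>lborel)"
    by (rule nn_integral_cmult) measurable
  also have "(\<integral>\<^sup>+x. (\<integral>\<^sup>+h. indicator Q h * D x h \<partial>lborel) \<partial>lborel)
    = (\<integral>\<^sup>+h. (\<integral>\<^sup>+x. indicator Q h * D x h \<partial>lborel) \<partial>lborel)"
    by (rule lborel_pair.Fubini') measurable
  also have "\<dots> \<le> (\<integral>\<^sup>+h. ennreal (real CARD('d) * r\<^sup>2) * band_energy u G l * indicator Q h \<partial>lborel)"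
  proof (rule nn_integral_mono)
    fix h
    show "(\<integral>\<^sup>+x. indicator Q h * D x h \<partial>lborel) \<le> ennreal (real CARD('d) * r\<^sup>2) * band_energy u G l * indicator Q h"
    proof (cases "h \<in> Q")
      case True
      then have "(\<integral>\<^sup>+x. indicator Q h * D x h \<partial>lborel) \<le> ennreal ((norm h)\<^sup>2) * band_energy u G l"
        using clip_translation_L2[OF u G w l, of h] by (simp add: D_def)
      also have "\<dots> \<le> ennreal (real CARD('d) * r\<^sup>2) * band_energy u G l"
        by (intro mult_right_mono ennreal_leI hQ True) simp
      finally show ?thesis using True by simp
    qed simp
  qed
  also have "\<dots> = ennreal (real CARD('d) * r\<^sup>2) * band_energy u G l * R"
    by (subst nn_integral_cmult_indicator) (auto simp: Q R_def)
  finally have "R * (ennreal (l\<^sup>2) * emeasure lborel {x. 2 * l < norm (u x)})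
    \<le> 2 * (ennreal (real CARD('d) * r\<^sup>2) * band_energy u G l * R)"
    by (simp add: mult_left_mono)
  also have "\<dots> = R * (ennreal (2 * real CARD('d) * r\<^sup>2) * band_energy u G l)"
    by (simp add: ennreal_mult mult_ac)
  finally show ?thesis using R by (simp add: ennreal_mult_le_mult_iff)
qed

section \<open>Dyadic level sets\<close>

definition moment :: "nat \<Rightarrow> ('a::euclidean_space \<Rightarrow> 'b::real_normed_vector) \<Rightarrow> ennreal" where
  "moment p f = (\<integral>\<^sup>+x. ennreal (norm (f x) ^ p) \<partial>lborel)"

definition level :: "('a::euclidean_space \<Rightarrow> 'b::real_normed_vector) \<Rightarrow> real \<Rightarrow> real" where
  "level f l = measure lborel {x. l < norm (f x)}"

lemma moment2_finite: "f \<in> L2 \<Longrightarrow> moment 2 f < \<infinity>"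
  unfolding moment_def by (rule L2_finite)

lemma chebyshev_ennreal:
  assumes f: "f \<in> borel_measurable borel" and l: "0 < l"
  shows "ennreal (l\<^sup>2) * emeasure lborel {x. l < norm (f x)} \<le> moment 2 f"
proof -
  note [measurable] = f
  have "ennreal (l\<^sup>2) * emeasure lborel {x. l < norm (f x)} = (\<integral>\<^sup>+x. ennreal (l\<^sup>2) * indicator {x. l < norm (f x)} x \<partial>lborel)"
    by (rule nn_integral_cmult_indicator[symmetric]) measurable
  also have "\<dots> \<le> moment 2 f"
    unfolding moment_def using l
    by (intro nn_integral_mono) (auto simp: indicator_def intro!: ennreal_leI power_mono)
  finally show ?thesis .
qed

lemma emeasure_level:
  assumes f: "f \<in> L2" and l: "0 < l"
  shows "emeasure lborel {x. l < norm (f x)} = ennreal (level f l)"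
proof -
  have "ennreal (l\<^sup>2) * emeasure lborel {x. l < norm (f x)} < \<infinity>"
    using chebyshev_ennreal[OF L2_measurable[OF f] l] moment2_finite[OF f] by (rule le_less_trans)
  then have "emeasure lborel {x. l < norm (f x)} \<noteq> \<infinity>"
    using l by (auto simp: ennreal_mult_less_top)
  then show ?thesis unfolding level_def by (simp add: emeasure_eq_ennreal_measure)
qed

lemma level_nonneg: "0 \<le> level f l"
  by (simp add: level_def)

lemma chebyshev:
  assumes f: "f \<in> L2" and l: "0 < l"
  shows "l\<^sup>2 * level f l \<le> enn2real (moment 2 f)"
proof -
  have "ennreal (l\<^sup>2 * level f l) \<le> moment 2 f"
    using chebyshev_ennreal[OF L2_measurable[OF f] l]
    by (simp add: emeasure_level[OF f l] ennreal_mult level_nonneg)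
  then show ?thesis
    using moment2_finite[OF f] by (metis enn2real_mono enn2real_ennreal level_nonneg mult_nonneg_nonneg zero_le_power2 infinity_ennreal_def)
qed

lemma level_antimono:
  assumes f: "f \<in> L2" and l: "0 < l" "l \<le> m"
  shows "level f m \<le> level f l"
proof -
  have [measurable]: "f \<in> borel_measurable borel" using f by (rule L2_measurable)
  have "emeasure lborel {x. m < norm (f x)} \<le> emeasure lborel {x. l < norm (f x)}"
    using l by (intro emeasure_mono) auto
  then show ?thesis using l by (simp add: emeasure_level[OF f] level_nonneg)
qed

lemma band_energy_finite:
  assumes G: "G \<in> L2"
  shows "band_energy u G l < \<infinity>"
proof -
  have "band_energy u G l \<le> (\<integral>\<^sup>+x. ennreal (norm (G x) ^ 2) \<partial>lborel)"
    unfolding band_energy_def by (intro nn_integral_mono) (simp add: indicator_def)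
  also note L2_finite[OF G]
  finally show ?thesis .
qed

text \<open>
  The side of the cube is chosen as small as possible, with volume exactly twice the measure of the level set.
  If that measure is zero there is no such cube, but then the left-hand side is zero.
\<close>

lemma level_set_step:
  fixes u :: "real ^ 'd \<Rightarrow> complex"
  assumes u: "u \<in> L2" and G: "G \<in> L2" and w: "is_weak_gradient u G" and l: "0 < l"
  shows "l\<^sup>2 * level u (2 * l) \<le> 2 * real CARD('d) * (root CARD('d) (2 * level u l))\<^sup>2 * enn2real (band_energy u G l)"
proof (cases "level u l = 0")
  case True
  then have "level u (2 * l) = 0"
    using level_antimono[OF u l, of "2 * l"] level_nonneg[of u "2 * l"] l by simp
  then show ?thesis by simp
next
  case False
  then have pos: "0 < level u l" using level_nonneg[of u l] by linarith
  let ?r = "root CARD('d) (2 * level u l)"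
  have r: "0 < ?r" using pos by simp
  have "2 * emeasure lborel {x. l < norm (u x)} \<le> ennreal (?r ^ CARD('d))"
    using pos by (simp add: emeasure_level[OF u l] ennreal_mult)
  from level_set_step_ennreal[OF u G w l r this]
  have "ennreal (l\<^sup>2 * level u (2 * l)) \<le> ennreal (2 * real CARD('d) * ?r\<^sup>2 * enn2real (band_energy u G l))"
    using band_energy_finite[OF G, of u l] l
    by (simp add: emeasure_level[OF u] ennreal_mult level_nonneg less_top)
  then show ?thesis
    by (subst (asm) ennreal_le_iff) (auto intro!: mult_nonneg_nonneg)
qed

lemma sum_indicator_bands:
  assumes "0 < l"
  shows "(\<Sum>k<N. indicator (band (2 ^ k * l)) z :: ennreal) \<le> indicator {..2 ^ N * l} z"
proof (induction N)
  case (Suc N)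
  have "2 ^ N * l \<le> 2 ^ Suc N * l" using assms by simp
  then show ?case using Suc by (auto simp: indicator_def split: if_splits)
qed simp

text \<open>
  The dyadic bands are disjoint. That their energies add up, and are not merely
  bounded one by one, is what makes the summation over all levels possible.
\<close>

lemma sum_band_energy_le:
  assumes u: "u \<in> L2" and G: "G \<in> L2" and l: "0 < l"
  shows "(\<Sum>k<N. enn2real (band_energy u G (2 ^ k * l))) \<le> enn2real (moment 2 G)"
proof -
  have [measurable]: "u \<in> borel_measurable borel" "G \<in> borel_measurable borel"
    using u G by (auto intro: L2_measurable)
  have "(\<Sum>k<N. band_energy u G (2 ^ k * l))
    = (\<integral>\<^sup>+x. (\<Sum>k<N. ennreal (norm (G x) ^ 2) * indicator {y. norm (u y) \<in> band (2 ^ k * l)} x) \<partial>lborel)"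
    unfolding band_energy_def by (rule nn_integral_sum[symmetric]) measurable
  also have "\<dots> \<le> moment 2 G"
    unfolding moment_def
  proof (rule nn_integral_mono)
    fix x
    have "(\<Sum>k<N. ennreal (norm (G x) ^ 2) * indicator {y. norm (u y) \<in> band (2 ^ k * l)} x)
      = ennreal (norm (G x) ^ 2) * (\<Sum>k<N. indicator (band (2 ^ k * l)) (norm (u x)))"
      by (simp add: sum_distrib_left indicator_def mult.commute)
    also have "\<dots> \<le> ennreal (norm (G x) ^ 2) * 1"
      by (intro mult_left_mono order_trans[OF sum_indicator_bands[OF l]]) (simp_all add: indicator_def)
    finally show "(\<Sum>k<N. ennreal (norm (G x) ^ 2) * indicator {y. norm (u y) \<in> band (2 ^ k * l)} x)
      \<le> ennreal (norm (G x) ^ 2)" by simp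
  qed
  finally have *: "(\<Sum>k<N. band_energy u G (2 ^ k * l)) \<le> moment 2 G" .
  have "(\<Sum>k<N. enn2real (band_energy u G (2 ^ k * l))) = enn2real (\<Sum>k<N. band_energy u G (2 ^ k * l))"
    using band_energy_finite[OF G] by (subst enn2real_sum) (simp_all add: comp_def)
  also have "\<dots> \<le> enn2real (moment 2 G)"
    by (rule enn2real_mono[OF *]) (use moment2_finite[OF G] in simp)
  finally show ?thesis .
qed

lemma dyadic_level_exists:
  fixes z l :: real
  assumes "0 < l" "l < z"
  shows "\<exists>k. 2 ^ k * l < z \<and> z \<le> 2 ^ Suc k * l"
proof -
  obtain n where n: "z / l < 2 ^ n" using real_arch_pow[of 2 "z / l"] by auto
  then have ex: "z \<le> 2 ^ n * l" using assms by (simp add: field_simps)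
  define m where "m = (LEAST n. z \<le> 2 ^ n * l)"
  have m: "z \<le> 2 ^ m * l" unfolding m_def by (rule LeastI[of "\<lambda>n. z \<le> 2 ^ n * l", OF ex])
  then have "m \<noteq> 0" using assms by (intro notI) simp
  then obtain k where k: "m = Suc k" using not0_implies_Suc by blast
  have "\<not> z \<le> 2 ^ k * l" using not_less_Least[of k "\<lambda>n. z \<le> 2 ^ n * l"] k by (simp add: m_def)
  then show ?thesis using m k by (intro exI[of _ k]) auto
qed

text \<open>
  Layer-cake decomposition: below the level \<open>l\<close> the power \<open>p\<close> is compared with the square, above it
  the function is rounded up to the next dyadic level.
\<close>

lemma moment_dyadic_bound:
  assumes u: "u \<in> L2" and l: "0 < l" and p: "2 \<le> p"
    and B: "\<And>N. (\<Sum>k<N. (2 ^ Suc k * l) ^ p * level u (2 ^ k * l)) \<le> B"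
  shows "moment p u \<le> ennreal (l ^ (p - 2) * enn2real (moment 2 u) + B)"
proof -
  have [measurable]: "u \<in> borel_measurable borel" using u by (rule L2_measurable)
  have B0: "0 \<le> B" using B[of 0] by simp
  let ?L = "\<lambda>k. {x. 2 ^ k * l < norm (u x)}"
  have "moment p u \<le> (\<integral>\<^sup>+x. ennreal (l ^ (p - 2)) * ennreal (norm (u x) ^ 2)
      + (\<Sum>k. ennreal ((2 ^ Suc k * l) ^ p) * indicator (?L k) x) \<partial>lborel)"
    unfolding moment_def
  proof (rule nn_integral_mono)
    fix x
    show "ennreal (norm (u x) ^ p) \<le> ennreal (l ^ (p - 2)) * ennreal (norm (u x) ^ 2)
      + (\<Sum>k. ennreal ((2 ^ Suc k * l) ^ p) * indicator (?L k) x)"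
    proof (cases "l < norm (u x)")
      case False
      have "norm (u x) ^ p = norm (u x) ^ (p - 2) * norm (u x) ^ 2"
        using p by (metis le_add_diff_inverse2 power_add)
      also have "\<dots> \<le> l ^ (p - 2) * norm (u x) ^ 2"
        using False by (intro mult_right_mono power_mono) auto
      finally have "ennreal (norm (u x) ^ p) \<le> ennreal (l ^ (p - 2) * norm (u x) ^ 2)"
        by (rule ennreal_leI)
      also have "\<dots> = ennreal (l ^ (p - 2)) * ennreal (norm (u x) ^ 2)"
        using l by (simp add: ennreal_mult)
      finally show ?thesis by (rule order_trans) simp
    next
      case True
      then obtain k where k: "2 ^ k * l < norm (u x)" "norm (u x) \<le> 2 ^ Suc k * l"
        using dyadic_level_exists[OF l] by blast
      have "ennreal (norm (u x) ^ p) \<le> ennreal ((2 ^ Suc k * l) ^ p) * indicator (?L k) x"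
        using k by (auto intro!: ennreal_leI power_mono)
      also have "\<dots> = (\<Sum>j\<in>{k}. ennreal ((2 ^ Suc j * l) ^ p) * indicator (?L j) x)"
        by (subst sum.insert) simp_all
      also have "\<dots> \<le> (\<Sum>k. ennreal ((2 ^ Suc k * l) ^ p) * indicator (?L k) x)"
        by (rule sum_le_suminf) auto
      finally show ?thesis by (rule order_trans) simp
    qed
  qed
  also have "\<dots> = ennreal (l ^ (p - 2)) * moment 2 u
      + (\<Sum>k. ennreal ((2 ^ Suc k * l) ^ p) * emeasure lborel (?L k))"
    unfolding moment_def
    by (subst nn_integral_add, measurable, subst nn_integral_suminf, measurable,
        subst nn_integral_cmult, measurable, subst nn_integral_cmult_indicator, measurable)
  also have "ennreal (l ^ (p - 2)) * moment 2 u = ennreal (l ^ (p - 2) * enn2real (moment 2 u))"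
    using l moment2_finite[OF u] by (simp add: ennreal_mult less_top)
  also have "(\<Sum>k. ennreal ((2 ^ Suc k * l) ^ p) * emeasure lborel (?L k)) \<le> ennreal B"
  proof -
    have "(\<Sum>k. ennreal ((2 ^ Suc k * l) ^ p) * emeasure lborel (?L k))
      = (SUP N. \<Sum>k<N. ennreal ((2 ^ Suc k * l) ^ p) * emeasure lborel (?L k))"
      by (rule suminf_eq_SUP)
    also have "\<dots> \<le> ennreal B"
    proof (rule SUP_least)
      fix N
      have "(\<Sum>k<N. ennreal ((2 ^ Suc k * l) ^ p) * emeasure lborel (?L k))
        = (\<Sum>k<N. ennreal ((2 ^ Suc k * l) ^ p * level u (2 ^ k * l)))"
        using l by (intro sum.cong) (simp_all add: emeasure_level[OF u] ennreal_mult level_nonneg)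
      also have "\<dots> = ennreal (\<Sum>k<N. (2 ^ Suc k * l) ^ p * level u (2 ^ k * l))"
        using l by (intro sum_ennreal) (simp add: level_nonneg)
      also have "\<dots> \<le> ennreal B" using B by (rule ennreal_leI)
      finally show "(\<Sum>k<N. ennreal ((2 ^ Suc k * l) ^ p) * emeasure lborel (?L k)) \<le> ennreal B" .
    qed
    finally show ?thesis .
  qed
  also have "ennreal (l ^ (p - 2) * enn2real (moment 2 u)) + ennreal B
      = ennreal (l ^ (p - 2) * enn2real (moment 2 u) + B)"
    using l B0 by (subst ennreal_plus) auto
  finally show ?thesis by (simp add: add_left_mono)
qed

section \<open>The Sobolev inequality in dimension three\<close>

text \<open>
  If \<open>R\<close> exceeds \<open>2 * B\<close>, the quadratic term is at most half of the cubic one and can be absorbed.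
\<close>

lemma cubic_alternative:
  fixes R A B :: real
  assumes "R ^ 3 \<le> A + B * R\<^sup>2" "0 \<le> R" "0 \<le> A" "0 \<le> B"
  shows "R ^ 3 \<le> 2 * A + (2 * B) ^ 3"
proof (cases "R \<le> 2 * B")
  case True
  then have "R ^ 3 \<le> (2 * B) ^ 3" using assms by (intro power_mono)
  then show ?thesis using assms by simp
next
  case False
  then have "2 * B * R\<^sup>2 \<le> R * R\<^sup>2" by (intro mult_right_mono) auto
  then have "2 * B * R\<^sup>2 \<le> R ^ 3" by (simp add: power2_eq_square power3_eq_cube mult.assoc)
  then have "R ^ 3 \<le> 2 * A" using assms by linarith
  moreover have "0 \<le> (2 * B) ^ 3" using assms by simp
  ultimately show ?thesis by linarith
qed

text \<open>
  Write $a_k$ for the measure of $\{|u| > m_k\}$ with $m_k = 2^k l$, and $X$ for a partial sum of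
  $\sum_k m_k^6 a_k$. The level set estimate bounds $m_{k+1}^6 a_{k+1}$ by the energy of the \<open>k\<close>-th band
  times a multiple of $(m_k^6 a_k)^{2/3} \le X^{2/3}$. Summing over \<open>k\<close> gives
  $X \le l^4\|u\|_2^2 + C\|\nabla u\|_2^2\,X^{2/3}$. Partial sums are finite, so this can be solved for
  \<open>X\<close>, and the first term disappears as \<open>l\<close> tends to zero.
\<close>

lemma sobolev_dim3:
  fixes u :: "real ^ 'd \<Rightarrow> complex"
  assumes d: "CARD('d) = 3"
    and u: "u \<in> L2" and G: "G \<in> L2" and w: "is_weak_gradient u G"
  shows "moment 6 u \<le> ennreal (32 * (1536 * enn2real (moment 2 G)) ^ 3)"
proof -
  define g where "g = enn2real (moment 2 G)"
  define \<rho> where "\<rho> = enn2real (moment 2 u)"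
  have g0: "0 \<le> g" and \<rho>0: "0 \<le> \<rho>" by (simp_all add: g_def \<rho>_def)
  have bound: "moment 6 u \<le> ennreal (129 * l ^ 4 * \<rho> + 32 * (1536 * g) ^ 3)" if l: "0 < l" for l
  proof -
    define a where "a k = level u (2 ^ k * l)" for k
    define c where "c k = enn2real (band_energy u G (2 ^ k * l))" for k
    have a0: "0 \<le> a k" and c0: "0 \<le> c k" for k by (simp_all add: a_def c_def level_nonneg)
    define X where "X N = (\<Sum>k<N. (2 ^ k * l) ^ 6 * a k)" for N
    have XX: "X N \<le> 2 * (l ^ 4 * \<rho>) + (1536 * g) ^ 3 / 2" for N
    proof -
      have X0: "0 \<le> X N" unfolding X_def by (intro sum_nonneg mult_nonneg_nonneg a0) simp
      \<comment> \<open>The factor 2 matches the cubes in \<open>level_set_step\<close>, whose volume is twice that of the level set.\<close>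
      define R where "R = root 3 (2 * X N)"
      have R3: "R ^ 3 = 2 * X N" unfolding R_def using X0 by simp
      have R0: "0 \<le> R" unfolding R_def using X0 by simp
      have step: "(2 ^ Suc k * l) ^ 6 * a (Suc k) \<le> 384 * R\<^sup>2 * c k" if k: "k < N" for k
      proof -
        define m where "m = 2 ^ k * l"
        have m: "0 < m" using l by (simp add: m_def)
        define r where "r = root 3 (2 * a k)"
        have r0: "0 \<le> r" unfolding r_def using a0[of k] by simp
        have r3: "r ^ 3 = 2 * a k" unfolding r_def using a0[of k] by simp
        have "m ^ 6 * a k \<le> X N"
          unfolding X_def m_def
          by (rule member_le_sum[of k "{..<N}" "\<lambda>k. (2 ^ k * l) ^ 6 * a k"]) (use k a0 in auto)
        then have "(m\<^sup>2 * r) ^ 3 \<le> R ^ 3"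
          by (simp add: power_mult_distrib R3 r3 power_mult[symmetric])
        then have mr: "m\<^sup>2 * r \<le> R"
          using power_strict_mono[of R "m\<^sup>2 * r" 3] R0 by (intro leI) auto
        have "m\<^sup>2 * a (Suc k) \<le> 6 * r\<^sup>2 * c k"
          using level_set_step[OF u G w m] unfolding a_def c_def r_def m_def d by (simp add: mult.assoc)
        \<comment> \<open>The factor 64 is \<open>2 ^ 6\<close>, from the passage to the next level.\<close>
        then have "64 * m ^ 4 * (m\<^sup>2 * a (Suc k)) \<le> 64 * m ^ 4 * (6 * r\<^sup>2 * c k)"
          by (rule mult_left_mono) simp
        also have "64 * m ^ 4 * (6 * r\<^sup>2 * c k) = 384 * (m\<^sup>2 * r)\<^sup>2 * c k"
          by (simp add: power_mult_distrib power_mult[symmetric])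
        also have "\<dots> \<le> 384 * R\<^sup>2 * c k"
          using mr m r0 c0[of k] by (intro mult_right_mono mult_left_mono power_mono) auto
        also have "64 * m ^ 4 * (m\<^sup>2 * a (Suc k)) = (2 ^ Suc k * l) ^ 6 * a (Suc k)"
        proof -
          have "m ^ 4 * m\<^sup>2 = m ^ 6" by (simp add: power_add[symmetric])
          moreover have "(2 ^ Suc k * l) ^ 6 = 64 * m ^ 6" unfolding m_def by (simp add: power_mult_distrib)
          ultimately show ?thesis by (simp add: mult.assoc[symmetric])
        qed
        finally show ?thesis .
      qed
      have "X N \<le> l ^ 6 * a 0 + (\<Sum>k<N. (2 ^ Suc k * l) ^ 6 * a (Suc k))"
      proof (cases N)
        case 0
        then show ?thesis using a0[of 0] by (simp add: X_def)
      next
        case (Suc n)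
        have "X N = l ^ 6 * a 0 + (\<Sum>k<n. (2 ^ Suc k * l) ^ 6 * a (Suc k))"
          unfolding X_def Suc sum.lessThan_Suc_shift by simp
        also have "(\<Sum>k<n. (2 ^ Suc k * l) ^ 6 * a (Suc k)) \<le> (\<Sum>k<N. (2 ^ Suc k * l) ^ 6 * a (Suc k))"
          unfolding Suc using a0 by (simp add: mult_nonneg_nonneg)
        finally show ?thesis by simp
      qed
      also have "(\<Sum>k<N. (2 ^ Suc k * l) ^ 6 * a (Suc k)) \<le> (\<Sum>k<N. 384 * R\<^sup>2 * c k)"
        by (intro sum_mono step) simp
      also have "\<dots> = 384 * R\<^sup>2 * (\<Sum>k<N. c k)" by (rule sum_distrib_left[symmetric])
      also have "\<dots> \<le> 384 * R\<^sup>2 * g"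
        unfolding c_def g_def by (intro mult_left_mono sum_band_energy_le[OF u G l]) simp
      also have "l ^ 6 * a 0 \<le> l ^ 4 * \<rho>"
      proof -
        have "l ^ 4 * (l\<^sup>2 * a 0) \<le> l ^ 4 * \<rho>"
          unfolding a_def \<rho>_def using chebyshev[OF u l] l by (intro mult_left_mono) auto
        moreover have "l ^ 4 * (l\<^sup>2 * a 0) = l ^ 6 * a 0" by (simp add: power_add[symmetric] mult.assoc[symmetric])
        ultimately show ?thesis by simp
      qed
      finally have "R ^ 3 \<le> 2 * (l ^ 4 * \<rho>) + (768 * g) * R\<^sup>2"
        unfolding R3 by (simp add: algebra_simps)
      from cubic_alternative[OF this R0] show ?thesis using g0 \<rho>0 by (simp add: R3)
    qed
    have "moment 6 u \<le> ennreal (l ^ (6 - 2) * enn2real (moment 2 u) + (128 * l ^ 4 * \<rho> + 32 * (1536 * g) ^ 3))"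
    proof (rule moment_dyadic_bound[OF u l])
      fix N
      have "(\<Sum>k<N. (2 ^ Suc k * l) ^ 6 * level u (2 ^ k * l)) = 64 * X N"
        unfolding X_def sum_distrib_left a_def by (intro sum.cong refl) (simp add: power_mult_distrib)
      then show "(\<Sum>k<N. (2 ^ Suc k * l) ^ 6 * level u (2 ^ k * l)) \<le> 128 * l ^ 4 * \<rho> + 32 * (1536 * g) ^ 3"
        using XX[of N] by simp
    qed simp
    then show ?thesis unfolding \<rho>_def[symmetric] by (simp add: algebra_simps)
  qed
  show ?thesis
  proof (rule ennreal_le_epsilon)
    fix e :: real assume e: "0 < e"
    define l where "l = min 1 (e / (129 * \<rho> + 1))"
    have l: "0 < l" "l \<le> 1" "l \<le> e / (129 * \<rho> + 1)" using e \<rho>0 by (auto simp: l_def)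
    have "129 * l ^ 4 * \<rho> \<le> 129 * l * \<rho>"
      using power_decreasing[of 1 4 l] l \<rho>0 by (intro mult_right_mono mult_left_mono) auto
    also have "\<dots> \<le> l * (129 * \<rho> + 1)" using l by (simp add: algebra_simps)
    also have "\<dots> \<le> e" using l(3) \<rho>0 by (simp add: pos_le_divide_eq)
    finally have "ennreal (129 * l ^ 4 * \<rho> + 32 * (1536 * g) ^ 3) \<le> ennreal (32 * (1536 * g) ^ 3 + e)"
      by (intro ennreal_leI) simp
    also have "\<dots> = ennreal (32 * (1536 * g) ^ 3) + ennreal e"
      using g0 e by (intro ennreal_plus) auto
    finally have "ennreal (129 * l ^ 4 * \<rho> + 32 * (1536 * g) ^ 3) \<le> ennreal (32 * (1536 * g) ^ 3) + ennreal e" .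
    then show "moment 6 u \<le> ennreal (32 * (1536 * enn2real (moment 2 G)) ^ 3) + ennreal e"
      using bound[OF l(1)] unfolding g_def by (rule order_trans[rotated])
  qed
qed

section \<open>Functions close to a bounded function\<close>

lemma L2_diff:
  assumes "v \<in> L2" "u \<in> L2"
  shows "(\<lambda>x. v x - u x) \<in> (L2 :: (real ^ 'd \<Rightarrow> complex) set)"
proof -
  have [measurable]: "v \<in> borel_measurable borel" "u \<in> borel_measurable borel"
    using assms by (auto intro: L2_measurable)
  have "(\<integral>\<^sup>+x. ennreal (norm (v x - u x) ^ 2) \<partial>lborel)
    \<le> (\<integral>\<^sup>+x. 2 * ennreal (norm (v x) ^ 2) + 2 * ennreal (norm (u x) ^ 2) \<partial>lborel)"
  proof (rule nn_integral_mono)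
    fix x
    have "norm (v x - u x) ^ 2 \<le> (norm (v x) + norm (u x)) ^ 2"
      by (intro power_mono norm_triangle_ineq4) simp
    also have "\<dots> \<le> 2 * norm (v x) ^ 2 + 2 * norm (u x) ^ 2"
      using zero_le_power2[of "norm (v x) - norm (u x)"] by (simp add: power2_sum power2_diff)
    finally have "ennreal (norm (v x - u x) ^ 2) \<le> ennreal (2 * norm (v x) ^ 2 + 2 * norm (u x) ^ 2)"
      by (rule ennreal_leI)
    then show "ennreal (norm (v x - u x) ^ 2) \<le> 2 * ennreal (norm (v x) ^ 2) + 2 * ennreal (norm (u x) ^ 2)"
      by (simp add: ennreal_plus ennreal_mult)
  qed
  also have "\<dots> = 2 * moment 2 v + 2 * moment 2 u"
    unfolding moment_def
    by (subst nn_integral_add, measurable, subst nn_integral_cmult, measurable, subst nn_integral_cmult, measurable)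
  also have "\<dots> < \<infinity>" using moment2_finite[OF assms(1)] moment2_finite[OF assms(2)]
    by (auto simp: ennreal_mult_less_top)
  finally show ?thesis
    unfolding L2_def using Lp_norm_finite_iff[of "Num.Bit0 Num.One" "\<lambda>x. v x - u x"] by simp
qed

text \<open>
  Where $|u| > m \ge 2\eta$ and $|v| \le \eta$, the difference exceeds half of \<open>m\<close>; this is Chebyshev's
  inequality for the difference.
\<close>

lemma level_le_of_close_to_bounded:
  fixes u v :: "real ^ 'd \<Rightarrow> complex"
  assumes u: "u \<in> L2" and v: "v \<in> L2" and bd: "AE x in lborel. norm (v x) \<le> \<eta>"
    and m: "2 * \<eta> \<le> m" "0 < m"
  shows "m\<^sup>2 * level u m \<le> 4 * enn2real (moment 2 (\<lambda>x. v x - u x))"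
proof -
  let ?b = "\<lambda>x. v x - u x"
  have b: "?b \<in> L2" using L2_diff[OF v u] .
  have [measurable]: "v \<in> borel_measurable borel" "u \<in> borel_measurable borel"
    using u v by (auto intro: L2_measurable)
  have "emeasure lborel {x. m < norm (u x)} \<le> emeasure lborel {x. m / 2 < norm (?b x)}"
  proof (rule emeasure_mono_AE)
    show "AE x in lborel. x \<in> {x. m < norm (u x)} \<longrightarrow> x \<in> {x. m / 2 < norm (?b x)}"
      using bd
    proof (rule AE_mp, intro AE_I2 impI)
      fix x assume "norm (v x) \<le> \<eta>" "x \<in> {x. m < norm (u x)}"
      then show "x \<in> {x. m / 2 < norm (?b x)}"
        using m norm_triangle_ineq3[of "u x" "v x"] norm_minus_commute[of "u x" "v x"] by simp
    qed
  qed measurable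
  then have "ennreal (level u m) \<le> ennreal (level ?b (m / 2))"
    unfolding emeasure_level[OF u m(2)] emeasure_level[OF b half_gt_zero[OF m(2)]] .
  then have "level u m \<le> level ?b (m / 2)" by (simp add: level_nonneg)
  then have "m\<^sup>2 * level u m \<le> m\<^sup>2 * level ?b (m / 2)" by (rule mult_left_mono) simp
  also have "\<dots> = 4 * ((m / 2)\<^sup>2 * level ?b (m / 2))" by (simp add: power_divide)
  also have "\<dots> \<le> 4 * enn2real (moment 2 ?b)" using chebyshev[OF b, of "m / 2"] m by simp
  finally show ?thesis .
qed

text \<open>
  In dimension two the level set estimate is linear in the measure \<open>a(m)\<close>, and
  \<open>m\<^sup>2 * a(m)\<close> is bounded by the squared distance to the bounded function. So each dyadic level
  contributes a multiple of that distance times the energy of one band. The lowest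
  level \<open>l = 2 * \<eta>\<close> accounts for the term with the mass.
\<close>

lemma moment4_dim2_le:
  fixes u v :: "real ^ 'd \<Rightarrow> complex"
  assumes d: "CARD('d) = 2"
    and u: "u \<in> L2" and G: "G \<in> L2" and w: "is_weak_gradient u G"
    and v: "v \<in> L2" and bd: "AE x in lborel. norm (v x) \<le> \<eta>" and \<eta>: "0 < \<eta>"
  shows "moment 4 u \<le> ennreal (68 * \<eta>\<^sup>2 * enn2real (moment 2 u)
    + 8192 * enn2real (moment 2 (\<lambda>x. v x - u x)) * enn2real (moment 2 G))"
proof -
  define l where "l = 2 * \<eta>"
  have l: "0 < l" using \<eta> by (simp add: l_def)
  define g where "g = enn2real (moment 2 G)"
  define \<rho> where "\<rho> = enn2real (moment 2 u)"
  define \<beta> where "\<beta> = enn2real (moment 2 (\<lambda>x. v x - u x))"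
  define a where "a k = level u (2 ^ k * l)" for k
  define c where "c k = enn2real (band_energy u G (2 ^ k * l))" for k
  have a0: "0 \<le> a k" and c0: "0 \<le> c k" for k by (simp_all add: a_def c_def level_nonneg)
  have \<beta>0: "0 \<le> \<beta>" by (simp add: \<beta>_def)
  have step: "(2 ^ Suc (Suc k) * l) ^ 4 * a (Suc k) \<le> 8192 * \<beta> * c k" for k
  proof -
    define m where "m = 2 ^ k * l"
    have m: "0 < m" using l by (simp add: m_def)
    have "1 * l \<le> 2 ^ k * l" using l by (intro mult_right_mono) auto
    then have ml: "2 * \<eta> \<le> m" by (simp add: m_def l_def)
    have "m\<^sup>2 * a (Suc k) \<le> 4 * (sqrt (2 * a k))\<^sup>2 * c k"
      using level_set_step[OF u G w m] unfolding a_def c_def m_def d sqrt_def by (simp add: mult.assoc)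
    then have "m\<^sup>2 * a (Suc k) \<le> 8 * a k * c k" using a0[of k] by simp
    \<comment> \<open>The factor 256 is \<open>4 ^ 4\<close>: one level up, and rounded up once more.\<close>
    then have "256 * m\<^sup>2 * (m\<^sup>2 * a (Suc k)) \<le> 256 * m\<^sup>2 * (8 * a k * c k)"
      by (rule mult_left_mono) simp
    also have "256 * m\<^sup>2 * (8 * a k * c k) = 2048 * (m\<^sup>2 * a k) * c k" by simp
    also have "\<dots> \<le> 2048 * (4 * \<beta>) * c k"
      using level_le_of_close_to_bounded[OF u v bd ml m] c0[of k]
      by (intro mult_right_mono mult_left_mono) (auto simp: a_def m_def \<beta>_def)
    also have "256 * m\<^sup>2 * (m\<^sup>2 * a (Suc k)) = (2 ^ Suc (Suc k) * l) ^ 4 * a (Suc k)"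
    proof -
      have "m\<^sup>2 * m\<^sup>2 = m ^ 4" by (simp add: power_add[symmetric])
      moreover have "(2 ^ Suc (Suc k) * l) ^ 4 = 256 * m ^ 4"
        unfolding m_def by (simp add: power_mult_distrib)
      ultimately show ?thesis by (simp add: mult.assoc[symmetric])
    qed
    finally show ?thesis by simp
  qed
  have "moment 4 u \<le> ennreal (l ^ (4 - 2) * enn2real (moment 2 u) + (16 * l\<^sup>2 * \<rho> + 8192 * \<beta> * g))"
  proof (rule moment_dyadic_bound[OF u l])
    fix N
    let ?S = "\<lambda>N. \<Sum>k<N. (2 ^ Suc k * l) ^ 4 * a k"
    \<comment> \<open>The lowest level is split off, because the level set estimate controls a level only by the one below it.\<close>
    have "?S N \<le> ?S (Suc N)" using a0[of N] by simp
    also have "\<dots> = (2 * l) ^ 4 * a 0 + (\<Sum>k<N. (2 ^ Suc (Suc k) * l) ^ 4 * a (Suc k))"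
      by (subst sum.lessThan_Suc_shift) simp
    also have "(\<Sum>k<N. (2 ^ Suc (Suc k) * l) ^ 4 * a (Suc k)) \<le> (\<Sum>k<N. 8192 * \<beta> * c k)"
      by (intro sum_mono step)
    also have "\<dots> = 8192 * \<beta> * (\<Sum>k<N. c k)" by (rule sum_distrib_left[symmetric])
    also have "\<dots> \<le> 8192 * \<beta> * g"
      unfolding c_def g_def using \<beta>0 by (intro mult_left_mono sum_band_energy_le[OF u G l]) simp
    also have "(2 * l) ^ 4 * a 0 \<le> 16 * l\<^sup>2 * \<rho>"
    proof -
      have "(2 * l) ^ 4 * a 0 = 16 * l\<^sup>2 * (l\<^sup>2 * a 0)"
        by (simp add: power_mult_distrib power_add[symmetric] mult.assoc[symmetric])
      also have "\<dots> \<le> 16 * l\<^sup>2 * \<rho>"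
        unfolding a_def \<rho>_def using chebyshev[OF u l] by (intro mult_left_mono) auto
      finally show ?thesis .
    qed
    finally show "(\<Sum>k<N. (2 ^ Suc k * l) ^ 4 * level u (2 ^ k * l)) \<le> 16 * l\<^sup>2 * \<rho> + 8192 * \<beta> * g"
      by (simp add: a_def)
  qed simp
  also have "l ^ (4 - 2) * enn2real (moment 2 u) + (16 * l\<^sup>2 * \<rho> + 8192 * \<beta> * g)
    = 68 * \<eta>\<^sup>2 * \<rho> + 8192 * \<beta> * g"
    by (simp add: l_def \<rho>_def power_mult_distrib algebra_simps)
  finally show ?thesis by (simp add: \<rho>_def \<beta>_def g_def)
qed

text \<open>
  Where $|u| > 2\eta$ one has $|u| \le 2|v - u|$, hence $|u|^4 \le 2|v - u|\,|u|^3$. The weight \<open>\<tau>\<close> in the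
  inequality of arithmetic and geometric means is left free, to be matched to $\|u\|_4$.
\<close>

lemma moment4_interpolation_le:
  fixes u v :: "real ^ 'd \<Rightarrow> complex"
  assumes u: "u \<in> L2" and v: "v \<in> L2" and bd: "AE x in lborel. norm (v x) \<le> \<eta>" and \<eta>: "0 < \<eta>"
    and \<tau>: "0 < \<tau>" and fin: "moment 6 u < \<infinity>"
  shows "moment 4 u \<le> ennreal (4 * \<eta>\<^sup>2 * enn2real (moment 2 u)
    + enn2real (moment 2 (\<lambda>x. v x - u x)) / \<tau> + \<tau> * enn2real (moment 6 u))"
proof -
  let ?b = "\<lambda>x. v x - u x"
  have b: "?b \<in> L2" using L2_diff[OF v u] .
  have [measurable]: "v \<in> borel_measurable borel" "u \<in> borel_measurable borel"
    using u v by (auto intro: L2_measurable)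
  have "moment 4 u \<le> (\<integral>\<^sup>+x. ennreal (4 * \<eta>\<^sup>2) * ennreal (norm (u x) ^ 2)
      + ennreal (1 / \<tau>) * ennreal (norm (?b x) ^ 2) + ennreal \<tau> * ennreal (norm (u x) ^ 6) \<partial>lborel)"
    unfolding moment_def
  proof (rule nn_integral_mono_AE, rule AE_mp[OF bd], intro AE_I2 impI)
    fix x assume vx: "norm (v x) \<le> \<eta>"
    define f where "f = norm (u x)"
    define z where "z = norm (?b x)"
    have f0: "0 \<le> f" and z0: "0 \<le> z" by (simp_all add: f_def z_def)
    have "f ^ 4 \<le> 4 * \<eta>\<^sup>2 * f\<^sup>2 + 1 / \<tau> * z\<^sup>2 + \<tau> * f ^ 6"
    proof (cases "f \<le> 2 * \<eta>")
      case True
      have "f ^ 4 = f\<^sup>2 * f\<^sup>2" by (simp add: power_add[symmetric])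
      also have "\<dots> \<le> (2 * \<eta>)\<^sup>2 * f\<^sup>2" using True f0 by (intro mult_right_mono power_mono) auto
      finally have "f ^ 4 \<le> 4 * \<eta>\<^sup>2 * f\<^sup>2" by (simp add: power_mult_distrib)
      moreover have "0 \<le> 1 / \<tau> * z\<^sup>2" "0 \<le> \<tau> * f ^ 6" using \<tau> f0 by simp_all
      ultimately show ?thesis by linarith
    next
      case False
      have "f \<le> 2 * z"
        using False vx norm_triangle_ineq3[of "u x" "v x"] norm_minus_commute[of "u x" "v x"]
        by (simp add: f_def z_def)
      then have "f ^ 3 * f \<le> f ^ 3 * (2 * z)" using f0 by (intro mult_left_mono) auto
      then have "f ^ 4 \<le> 2 * z * f ^ 3" by (simp add: power_Suc[symmetric] mult.commute numeral_eq_Suc)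
      also have "\<dots> \<le> 1 / \<tau> * z\<^sup>2 + \<tau> * f ^ 6"
      proof -
        have "0 \<le> (z / sqrt \<tau> - sqrt \<tau> * f ^ 3)\<^sup>2" by simp
        also have "\<dots> = 1 / \<tau> * z\<^sup>2 + \<tau> * f ^ 6 - 2 * z * f ^ 3"
          using \<tau> by (simp add: power2_diff power_divide power_mult_distrib power_mult[symmetric])
        finally show ?thesis by simp
      qed
      finally have "f ^ 4 \<le> 1 / \<tau> * z\<^sup>2 + \<tau> * f ^ 6" .
      moreover have "0 \<le> 4 * \<eta>\<^sup>2 * f\<^sup>2" by simp
      ultimately show ?thesis by linarith
    qed
    then have "ennreal (f ^ 4) \<le> ennreal (4 * \<eta>\<^sup>2 * f\<^sup>2 + 1 / \<tau> * z\<^sup>2 + \<tau> * f ^ 6)" by (rule ennreal_leI)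
    also have "\<dots> = ennreal (4 * \<eta>\<^sup>2 * f\<^sup>2) + ennreal (1 / \<tau> * z\<^sup>2) + ennreal (\<tau> * f ^ 6)"
      using \<tau> f0 by (simp add: ennreal_plus)
    also have "\<dots> = ennreal (4 * \<eta>\<^sup>2) * ennreal (f\<^sup>2) + ennreal (1 / \<tau>) * ennreal (z\<^sup>2) + ennreal \<tau> * ennreal (f ^ 6)"
      using \<tau> f0 by (subst (1 2 3) ennreal_mult) auto
    finally show "ennreal (norm (u x) ^ 4) \<le> ennreal (4 * \<eta>\<^sup>2) * ennreal (norm (u x) ^ 2)
      + ennreal (1 / \<tau>) * ennreal (norm (?b x) ^ 2) + ennreal \<tau> * ennreal (norm (u x) ^ 6)"
      by (simp only: f_def z_def)
  qed
  also have "\<dots> = ennreal (4 * \<eta>\<^sup>2) * moment 2 u + ennreal (1 / \<tau>) * moment 2 ?b + ennreal \<tau> * moment 6 u"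
    unfolding moment_def by (simp add: nn_integral_add nn_integral_cmult)
  also have "\<dots> = ennreal (4 * \<eta>\<^sup>2 * enn2real (moment 2 u)) + ennreal (1 / \<tau> * enn2real (moment 2 ?b)) + ennreal (\<tau> * enn2real (moment 6 u))"
    using moment2_finite[OF u] moment2_finite[OF b] fin \<tau>
    by (subst (1 2 3) ennreal_mult) (auto simp: less_top)
  also have "\<dots> = ennreal (4 * \<eta>\<^sup>2 * enn2real (moment 2 u)
    + enn2real (moment 2 ?b) / \<tau> + \<tau> * enn2real (moment 6 u))"
    using \<tau> by (simp add: ennreal_plus)
  finally show ?thesis .
qed

section \<open>Functions of negative energy\<close>

lemma H1_weak_gradient:
  assumes "u \<in> H1"
  shows "u \<in> L2" "weak_gradient u \<in> L2" "is_weak_gradient u (weak_gradient u)"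
proof -
  show "u \<in> L2" using assms by (simp add: H1_def)
  have "\<exists>G. G \<in> L2 \<and> is_weak_gradient u G" using assms by (auto simp: H1_def)
  then have "weak_gradient u \<in> L2 \<and> is_weak_gradient u (weak_gradient u)"
    unfolding weak_gradient_def by (rule someI_ex)
  then show "weak_gradient u \<in> L2" "is_weak_gradient u (weak_gradient u)" by auto
qed

lemma Lp_norm_power_moment:
  "(enn2real (Lp_norm 2 f))\<^sup>2 = enn2real (moment 2 f)"
  "enn2real (Lp_norm 4 f) ^ 4 = enn2real (moment 4 f)"
  "enn2real (Lp_norm 6 f) ^ 6 = enn2real (moment 6 f)"
  unfolding moment_def by (rule Lp_norm_power)+

lemma mass_eq_moment: "mass u = enn2real (moment 2 u)"
  by (simp add: mass_def Lp_norm_power_moment)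

lemma energy_eq_moments:
  "energy u = 1/2 * enn2real (moment 2 (weak_gradient u)) - 1/2 * enn2real (moment 4 u) + 1/3 * enn2real (moment 6 u)"
  by (simp add: energy_def Lp_norm_power_moment)

text \<open>
  The Sobolev-type bounds above are used to absorb half of $\|u\|_4^4$ into the left-hand side. The
  threshold \<open>c\<close> depends only on the dimension because negative energy bounds both
  $\|\nabla u\|_2^2$ and $\frac23\|u\|_6^6$ by $\|u\|_4^4$, whatever the mass.
\<close>

lemma negative_energy_moment4_le:
  assumes d: "CARD('d::finite) = 2 \<or> CARD('d) = 3"
  shows "\<exists>c>0. \<forall>(u :: real ^ 'd \<Rightarrow> complex) \<in> H1. \<forall>v \<in> L2. \<forall>\<eta>>0.
    energy u < 0 \<longrightarrow> (AE x in lborel. norm (v x) \<le> \<eta>) \<longrightarrow> enn2real (moment 2 (\<lambda>x. v x - u x)) \<le> c\<^sup>2 \<longrightarrow>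
    enn2real (moment 4 u) \<le> 136 * \<eta>\<^sup>2 * mass u"
  using d
proof
  assume d2: "CARD('d) = 2"
  show ?thesis
  proof (intro exI[of _ "1/128"] conjI ballI allI impI)
    fix u v :: "real ^ 'd \<Rightarrow> complex" and \<eta> :: real
    assume u: "u \<in> H1" and v: "v \<in> L2" and \<eta>: "0 < \<eta>" and E: "energy u < 0"
      and bd: "AE x in lborel. norm (v x) \<le> \<eta>"
      and close: "enn2real (moment 2 (\<lambda>x. v x - u x)) \<le> (1/128)\<^sup>2"
    define g where "g = enn2real (moment 2 (weak_gradient u))"
    define y where "y = enn2real (moment 4 u)"
    define \<beta> where "\<beta> = enn2real (moment 2 (\<lambda>x. v x - u x))"
    have g0: "0 \<le> g" and \<beta>0: "0 \<le> \<beta>" by (simp_all add: g_def \<beta>_def)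
    have gy: "g \<le> y"
      using E enn2real_nonneg[of "moment 6 u"] unfolding energy_eq_moments g_def y_def by linarith
    have "moment 4 u \<le> ennreal (68 * \<eta>\<^sup>2 * mass u + 8192 * \<beta> * g)"
      unfolding \<beta>_def g_def mass_eq_moment
      by (rule moment4_dim2_le[OF d2 H1_weak_gradient[OF u] v bd \<eta>])
    then have "y \<le> 68 * \<eta>\<^sup>2 * mass u + 8192 * \<beta> * g"
      unfolding y_def using g0 \<beta>0 by (intro enn2real_leI) (auto simp: mass_eq_moment)
    moreover have "8192 * \<beta> * g \<le> 1/2 * y"
    proof -
      have "8192 * \<beta> \<le> 1/2" using close by (simp add: \<beta>_def power2_eq_square)
      then have "8192 * \<beta> * g \<le> 1/2 * g" using g0 by (rule mult_right_mono)
      then show ?thesis using gy by linarith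
    qed
    ultimately show "enn2real (moment 4 u) \<le> 136 * \<eta>\<^sup>2 * mass u" unfolding y_def by linarith
  qed simp
next
  assume d3: "CARD('d) = 3"
  define C where "C = 32 * 1536 ^ 3 * (3/2 :: real)"
  define K where "K = sqrt C"
  have C0: "0 \<le> C" by (simp add: C_def)
  have K0: "0 \<le> K" using C0 by (simp add: K_def)
  show ?thesis
  proof (intro exI[of _ "1 / (2 * (1 + K))"] conjI ballI allI impI)
    show "0 < 1 / (2 * (1 + K))" using K0 by simp
    fix u v :: "real ^ 'd \<Rightarrow> complex" and \<eta> :: real
    assume u: "u \<in> H1" and v: "v \<in> L2" and \<eta>: "0 < \<eta>" and E: "energy u < 0"
      and bd: "AE x in lborel. norm (v x) \<le> \<eta>"
      and close: "enn2real (moment 2 (\<lambda>x. v x - u x)) \<le> (1 / (2 * (1 + K)))\<^sup>2"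
    define \<beta> where "\<beta> = 1 / (2 * (1 + K))"
    have \<beta>: "0 < \<beta>" using K0 by (simp add: \<beta>_def)
    define g where "g = enn2real (moment 2 (weak_gradient u))"
    define y where "y = enn2real (moment 4 u)"
    define z where "z = enn2real (moment 6 u)"
    have g0: "0 \<le> g" and z0: "0 \<le> z" by (simp_all add: g_def z_def)
    have gy: "g \<le> y" and zy: "z \<le> 3/2 * y" and y: "0 < y"
      using E g0 z0 unfolding energy_eq_moments g_def[symmetric] y_def[symmetric] z_def[symmetric] by linarith+
    \<comment> \<open>This also shows that the sixth moment is finite, so that \<open>z\<close> is its true value and not the default 0.\<close>
    have sob: "moment 6 u \<le> ennreal (32 * (1536 * g) ^ 3)"
      unfolding g_def by (rule sobolev_dim3[OF d3 H1_weak_gradient[OF u]])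
    then have fin: "moment 6 u < \<infinity>" by (rule le_less_trans) simp
    have "z \<le> 32 * (1536 * g) ^ 3" unfolding z_def using g0 sob by (intro enn2real_leI) auto
    also have "\<dots> \<le> 32 * (1536 * y) ^ 3" using g0 gy by (intro mult_left_mono power_mono) auto
    finally have "z * z \<le> 32 * (1536 * y) ^ 3 * (3/2 * y)"
      using zy z0 y by (intro mult_mono) auto
    \<comment> \<open>The product of the two upper bounds for \<open>z\<close> is of degree 4 in \<open>y\<close>, which makes \<open>z\<close> quadratic in \<open>y\<close>.\<close>
    also have "\<dots> = C * (y\<^sup>2)\<^sup>2" by (simp add: C_def power_mult_distrib power2_eq_square power3_eq_cube)
    also have "\<dots> = (K * y\<^sup>2)\<^sup>2" using C0 by (simp add: K_def power_mult_distrib)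
    finally have "z\<^sup>2 \<le> (K * y\<^sup>2)\<^sup>2" by (simp add: power2_eq_square)
    then have zK: "z \<le> K * y\<^sup>2" by (rule power2_le_imp_le) (use K0 in simp)
    \<comment> \<open>With the weight \<open>\<beta> / y\<close> both error terms become multiples of \<open>\<beta> * y\<close>.\<close>
    have "moment 4 u \<le> ennreal (4 * \<eta>\<^sup>2 * mass u
        + enn2real (moment 2 (\<lambda>x. v x - u x)) / (\<beta> / y) + \<beta> / y * z)"
      unfolding mass_eq_moment z_def
      by (rule moment4_interpolation_le[OF H1_weak_gradient(1)[OF u] v bd \<eta> _ fin]) (use \<beta> y in simp)
    then have "y \<le> 4 * \<eta>\<^sup>2 * mass u + enn2real (moment 2 (\<lambda>x. v x - u x)) / (\<beta> / y) + \<beta> / y * z"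
      unfolding y_def[symmetric] using \<beta> y z0
      by (subst y_def, intro enn2real_leI) (auto simp: mass_eq_moment intro!: add_nonneg_nonneg mult_nonneg_nonneg divide_nonneg_nonneg)
    moreover have "enn2real (moment 2 (\<lambda>x. v x - u x)) / (\<beta> / y) \<le> \<beta>\<^sup>2 / (\<beta> / y)"
      using close \<beta> y unfolding \<beta>_def[symmetric] by (intro divide_right_mono) auto
    moreover have "\<beta>\<^sup>2 / (\<beta> / y) = \<beta> * y" using \<beta> y by (simp add: power2_eq_square field_simps)
    moreover have "\<beta> / y * z \<le> \<beta> / y * (K * y\<^sup>2)" using \<beta> y zK by (intro mult_left_mono) auto
    moreover have "\<beta> / y * (K * y\<^sup>2) = \<beta> * K * y" using y by (simp add: power2_eq_square)
    moreover have "\<beta> * y + \<beta> * K * y = y / 2"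
    proof -
      have "\<beta> * (1 + K) = 1 / 2" using K0 by (simp add: \<beta>_def)
      then have "\<beta> * (1 + K) * y = 1 / 2 * y" by (simp only:)
      moreover have "\<beta> * (1 + K) * y = \<beta> * y + \<beta> * K * y" by (simp add: algebra_simps)
      ultimately show ?thesis by simp
    qed
    ultimately have "y \<le> 8 * \<eta>\<^sup>2 * mass u" by linarith
    moreover have "8 * \<eta>\<^sup>2 * mass u \<le> 136 * \<eta>\<^sup>2 * mass u"
      by (intro mult_right_mono) (auto simp: mass_eq_moment)
    ultimately show "enn2real (moment 4 u) \<le> 136 * \<eta>\<^sup>2 * mass u" unfolding y_def by linarith
  qed
qed

section \<open>Lower bounds for the norms of ground states\<close>

text \<open>
  Above the level \<open>l\<close> the fourth power is at most $l^{4-P}$ times the power \<open>P\<close>, because $P > 4$.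
\<close>

lemma moment4_le_Lp:
  assumes u: "u \<in> L2" and l: "0 < l" and P: "4 < P"
  shows "moment 4 u \<le> ennreal (l\<^sup>2 * enn2real (moment 2 u))
    + ennreal (l powr (4 - P)) * (\<integral>\<^sup>+x. ennreal (norm (u x) powr P) \<partial>lborel)"
proof -
  have [measurable]: "u \<in> borel_measurable borel" using u by (rule L2_measurable)
  have "moment 4 u \<le> (\<integral>\<^sup>+x. ennreal (l\<^sup>2) * ennreal (norm (u x) ^ 2)
    + ennreal (l powr (4 - P)) * ennreal (norm (u x) powr P) \<partial>lborel)"
    unfolding moment_def
  proof (rule nn_integral_mono)
    fix x
    let ?f = "norm (u x)"
    have "?f ^ 4 \<le> l\<^sup>2 * ?f ^ 2 + l powr (4 - P) * ?f powr P"
    proof (cases "?f \<le> l")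
      case True
      have "?f ^ 4 = ?f\<^sup>2 * ?f\<^sup>2" by (simp add: power_add[symmetric])
      also have "\<dots> \<le> l\<^sup>2 * ?f\<^sup>2" using True by (intro mult_right_mono power_mono) auto
      finally have "?f ^ 4 \<le> l\<^sup>2 * ?f\<^sup>2" .
      moreover have "0 \<le> l powr (4 - P) * ?f powr P" by simp
      ultimately show ?thesis by linarith
    next
      case False
      then have f: "0 < ?f" using l by linarith
      have "?f ^ 4 = ?f powr (4 - P) * ?f powr P"
        using f by (simp add: powr_add[symmetric])
      also have "\<dots> \<le> l powr (4 - P) * ?f powr P"
        using P l False by (intro mult_right_mono powr_mono2') auto
      finally have "?f ^ 4 \<le> l powr (4 - P) * ?f powr P" .
      moreover have "0 \<le> l\<^sup>2 * ?f ^ 2" by simp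
      ultimately show ?thesis by linarith
    qed
    then have "ennreal (?f ^ 4) \<le> ennreal (l\<^sup>2 * ?f ^ 2 + l powr (4 - P) * ?f powr P)" by (rule ennreal_leI)
    then show "ennreal (?f ^ 4) \<le> ennreal (l\<^sup>2) * ennreal (?f ^ 2) + ennreal (l powr (4 - P)) * ennreal (?f powr P)"
      by (simp add: ennreal_plus ennreal_mult)
  qed
  also have "\<dots> = ennreal (l\<^sup>2) * moment 2 u + ennreal (l powr (4 - P)) * (\<integral>\<^sup>+x. ennreal (norm (u x) powr P) \<partial>lborel)"
    unfolding moment_def by (simp add: nn_integral_add nn_integral_cmult)
  also have "ennreal (l\<^sup>2) * moment 2 u = ennreal (l\<^sup>2 * enn2real (moment 2 u))"
    using moment2_finite[OF u] by (simp add: ennreal_mult less_top)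
  finally show ?thesis .
qed

lemma moment4_le_bounded:
  assumes u: "u \<in> L2" and bd: "AE x in lborel. norm (u x) \<le> l"
  shows "moment 4 u \<le> ennreal (l\<^sup>2 * enn2real (moment 2 u))"
proof -
  have [measurable]: "u \<in> borel_measurable borel" using u by (rule L2_measurable)
  have "moment 4 u \<le> (\<integral>\<^sup>+x. ennreal (l\<^sup>2) * ennreal (norm (u x) ^ 2) \<partial>lborel)"
    unfolding moment_def
  proof (rule nn_integral_mono_AE, rule AE_mp[OF bd], intro AE_I2 impI)
    fix x
    let ?f = "norm (u x)"
    assume "?f \<le> l"
    have "?f ^ 4 = ?f\<^sup>2 * ?f\<^sup>2" by (simp add: power_add[symmetric])
    also have "\<dots> \<le> l\<^sup>2 * ?f\<^sup>2" using \<open>?f \<le> l\<close> by (intro mult_right_mono power_mono) auto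
    finally have "ennreal (?f ^ 4) \<le> ennreal (l\<^sup>2 * ?f\<^sup>2)" by (rule ennreal_leI)
    then show "ennreal (?f ^ 4) \<le> ennreal (l\<^sup>2) * ennreal (?f ^ 2)" by (simp add: ennreal_mult)
  qed
  also have "\<dots> = ennreal (l\<^sup>2) * moment 2 u" unfolding moment_def by (simp add: nn_integral_cmult)
  also have "\<dots> = ennreal (l\<^sup>2 * enn2real (moment 2 u))"
    using moment2_finite[OF u] by (simp add: ennreal_mult less_top)
  finally show ?thesis .
qed

lemma AE_le_of_Lp_norm_top_le:
  assumes "Lp_norm \<infinity> u \<le> ennreal c" "0 \<le> c"
  shows "AE x in lborel. norm (u x) \<le> c"
proof -
  have "AE x in lborel. ennreal (norm (u x)) \<le> Lp_norm \<infinity> u"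
    using esssup_AE[of "\<lambda>x. ennreal (norm (u x))" lborel] by (simp add: Lp_norm_def)
  then show ?thesis
  proof (rule AE_mp, intro AE_I2 impI)
    fix x assume "ennreal (norm (u x)) \<le> Lp_norm \<infinity> u"
    then have "ennreal (norm (u x)) \<le> ennreal c" using assms(1) by (rule order_trans)
    then show "norm (u x) \<le> c" using assms(2) by simp
  qed
qed

text \<open>
  The level is chosen such that $l^2\rho = m$ is half of the assumed lower bound for the fourth moment; the
  other half has to come from the $L^p$ norm.
\<close>

lemma Lp_norm_lower_bound:
  assumes m: "0 < m" and \<rho>: "0 < \<rho>" and p: "4 < p"
  shows "\<exists>c>0. \<forall>u\<in>(L2 :: (real ^ 'd \<Rightarrow> complex) set). mass u = \<rho> \<longrightarrow> 2 * m \<le> enn2real (moment 4 u) \<longrightarrow> c \<le> Lp_norm p u"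
proof (cases "p = \<infinity>")
  case True
  define c where "c = sqrt (m / \<rho>)"
  have c: "0 < c" "c\<^sup>2 * \<rho> = m" using m \<rho> by (simp_all add: c_def)
  have "ennreal c \<le> Lp_norm p u" if u: "u \<in> L2" and "mass u = \<rho>" and y: "2 * m \<le> enn2real (moment 4 u)"
    for u :: "real ^ 'd \<Rightarrow> complex"
  proof (rule ccontr)
    assume "\<not> ennreal c \<le> Lp_norm p u"
    then have "Lp_norm \<infinity> u \<le> ennreal c" using True by simp
    then have "AE x in lborel. norm (u x) \<le> c" using c by (intro AE_le_of_Lp_norm_top_le) auto
    from moment4_le_bounded[OF u this] have "enn2real (moment 4 u) \<le> c\<^sup>2 * enn2real (moment 2 u)"
      by (intro enn2real_leI) auto
    then show False using that(2) c(2) y m by (simp add: mass_eq_moment)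
  qed
  then show ?thesis using c by (intro exI[of _ "ennreal c"]) auto
next
  case False
  define P where "P = enn2real p"
  have P: "4 < P"
  proof -
    have "p = ennreal P" using False by (simp add: P_def less_top)
    moreover have "(4 :: ennreal) = ennreal 4" by simp
    ultimately show ?thesis using p by (metis ennreal_less_iff zero_le_numeral)
  qed
  define l where "l = sqrt (m / \<rho>)"
  have l: "0 < l" "l\<^sup>2 * \<rho> = m" using m \<rho> by (simp_all add: l_def)
  define q where "q = m / l powr (4 - P)"
  have q: "0 < q" using m l by (simp add: q_def)
  have "ennreal (q powr (1 / P)) \<le> Lp_norm p u"
    if u: "u \<in> L2" and \<rho>: "mass u = \<rho>" and y: "2 * m \<le> enn2real (moment 4 u)"
    for u :: "real ^ 'd \<Rightarrow> complex"
  proof -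
    define I where "I = (\<integral>\<^sup>+x. ennreal (norm (u x) powr P) \<partial>lborel)"
    show ?thesis
    proof (cases "I = \<infinity>")
      case True
      then show ?thesis using False by (simp add: Lp_norm_def Let_def I_def P_def)
    next
      case fin: False
      have "moment 4 u \<le> ennreal m + ennreal (l powr (4 - P)) * ennreal (enn2real I)"
        using moment4_le_Lp[OF u l(1) P] fin l(2) \<rho> unfolding I_def[symmetric]
        by (simp add: mass_eq_moment less_top)
      also have "\<dots> = ennreal (m + l powr (4 - P) * enn2real I)"
        using m by (simp add: ennreal_plus ennreal_mult)
      finally have "enn2real (moment 4 u) \<le> m + l powr (4 - P) * enn2real I"
        using m by (intro enn2real_leI) auto
      then have "m \<le> l powr (4 - P) * enn2real I" using y by linarith
      then have "q \<le> enn2real I" using l(1) by (simp add: q_def field_simps)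
      then have "q powr (1 / P) \<le> enn2real I powr (1 / P)"
        using q P by (intro powr_mono2) auto
      moreover have "Lp_norm p u = ennreal (enn2real I powr (1 / P))"
        using False fin by (simp add: Lp_norm_def Let_def I_def P_def)
      ultimately show ?thesis by (simp add: ennreal_leI)
    qed
  qed
  then show ?thesis using q by (intro exI[of _ "ennreal (q powr (1 / P))"]) auto
qed

text \<open>
  The lower bound holds because the gradient term and the sextic term of the energy are nonnegative.
\<close>

lemma ground_state_moment4:
  fixes \<phi> :: "real ^ 'd \<Rightarrow> complex"
  assumes "\<phi> \<in> ground_states \<rho>"
  shows "\<phi> \<in> H1" "\<phi> \<in> L2" "mass \<phi> = \<rho>" "energy \<phi> = E_min TYPE('d) \<rho>"
    "2 * (- E_min TYPE('d) \<rho>) \<le> enn2real (moment 4 \<phi>)"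
proof -
  show 1: "\<phi> \<in> H1" "mass \<phi> = \<rho>" "energy \<phi> = E_min TYPE('d) \<rho>"
    using assms by (auto simp: ground_states_def)
  show "\<phi> \<in> L2" using 1 by (simp add: H1_def)
  show "2 * (- E_min TYPE('d) \<rho>) \<le> enn2real (moment 4 \<phi>)"
    using 1(3) enn2real_nonneg[of "moment 6 \<phi>"] enn2real_nonneg[of "moment 2 (weak_gradient \<phi>)"]
    unfolding energy_eq_moments by linarith
qed

theorem proposition2p3:
  assumes "CARD('d::finite) = 2 \<or> CARD('d) = 3"
  shows "(\<forall>\<rho>>0. E_min TYPE('d) \<rho> < 0 \<longrightarrow>
            (\<forall>p::ennreal. 4 < p \<longrightarrow>
               0 < (INF \<phi> \<in> (ground_states \<rho> :: (real ^ 'd \<Rightarrow> complex) set). Lp_norm p \<phi>))) \<and>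
         (\<exists>\<epsilon>0>0. \<forall>\<rho>>0. E_min TYPE('d) \<rho> < 0 \<longrightarrow>
            (\<forall>\<epsilon> \<delta>. 0 < \<epsilon> \<and> \<epsilon> \<le> \<epsilon>0 \<and> stability_delta TYPE('d) \<rho> \<epsilon> \<delta> \<longrightarrow>
               (\<forall>u0\<in>H1. \<forall>u :: real \<Rightarrow> real ^ 'd \<Rightarrow> complex.
                  dist_ground_states \<rho> u0 \<le> ennreal \<delta> \<and> NLS_solution_from u0 u \<longrightarrow>
                  0 < (INF t. Lp_norm \<infinity> (u t)))))"
proof
  show "\<forall>\<rho>>0. E_min TYPE('d) \<rho> < 0 \<longrightarrow> (\<forall>p::ennreal. 4 < p \<longrightarrow>
      0 < (INF \<phi> \<in> (ground_states \<rho> :: (real ^ 'd \<Rightarrow> complex) set). Lp_norm p \<phi>))"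
  proof (intro allI impI)
    fix \<rho> :: real and p :: ennreal
    assume \<rho>: "0 < \<rho>" and E: "E_min TYPE('d) \<rho> < 0" and p: "4 < p"
    from E have "0 < - E_min TYPE('d) \<rho>" by simp
    from Lp_norm_lower_bound[OF this \<rho> p] obtain c where c: "0 < c"
      and bound: "\<forall>u\<in>(L2 :: (real ^ 'd \<Rightarrow> complex) set). mass u = \<rho> \<longrightarrow>
        2 * - E_min TYPE('d) \<rho> \<le> enn2real (moment 4 u) \<longrightarrow> c \<le> Lp_norm p u" by blast
    have "c \<le> (INF \<phi> \<in> (ground_states \<rho> :: (real ^ 'd \<Rightarrow> complex) set). Lp_norm p \<phi>)"
      using bound ground_state_moment4 by (intro INF_greatest) blast
    with c show "0 < (INF \<phi> \<in> (ground_states \<rho> :: (real ^ 'd \<Rightarrow> complex) set). Lp_norm p \<phi>)"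
      by (rule less_le_trans)
  qed
next
  obtain c where c: "0 < c" and near: "\<And>(u :: real ^ 'd \<Rightarrow> complex) v \<eta>. u \<in> H1 \<Longrightarrow> v \<in> L2 \<Longrightarrow> 0 < \<eta> \<Longrightarrow>
    energy u < 0 \<Longrightarrow> (AE x in lborel. norm (v x) \<le> \<eta>) \<Longrightarrow> enn2real (moment 2 (\<lambda>x. v x - u x)) \<le> c\<^sup>2 \<Longrightarrow>
    enn2real (moment 4 u) \<le> 136 * \<eta>\<^sup>2 * mass u"
    using negative_energy_moment4_le[OF assms] by blast
  show "\<exists>\<epsilon>0>0. \<forall>\<rho>>0. E_min TYPE('d) \<rho> < 0 \<longrightarrow>
            (\<forall>\<epsilon> \<delta>. 0 < \<epsilon> \<and> \<epsilon> \<le> \<epsilon>0 \<and> stability_delta TYPE('d) \<rho> \<epsilon> \<delta> \<longrightarrow>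
               (\<forall>u0\<in>H1. \<forall>u :: real \<Rightarrow> real ^ 'd \<Rightarrow> complex.
                  dist_ground_states \<rho> u0 \<le> ennreal \<delta> \<and> NLS_solution_from u0 u \<longrightarrow>
                  0 < (INF t. Lp_norm \<infinity> (u t))))"
  proof (intro exI[of _ "c / 2"] conjI allI impI ballI)
    show "0 < c / 2" using c by simp
    fix \<rho> \<epsilon> \<delta> :: real and u0 :: "real ^ 'd \<Rightarrow> complex" and u :: "real \<Rightarrow> real ^ 'd \<Rightarrow> complex"
    assume \<rho>: "0 < \<rho>" and E: "E_min TYPE('d) \<rho> < 0"
      and \<epsilon>: "0 < \<epsilon> \<and> \<epsilon> \<le> c / 2 \<and> stability_delta TYPE('d) \<rho> \<epsilon> \<delta>"
      and u0: "u0 \<in> H1" and sol: "dist_ground_states \<rho> u0 \<le> ennreal \<delta> \<and> NLS_solution_from u0 u"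
    define e where "e = - E_min TYPE('d) \<rho>"
    have e: "0 < e" using E by (simp add: e_def)
    \<comment> \<open>This makes \<open>136 * \<eta>\<^sup>2 * \<rho> = 1.36 * e\<close>, less than the lower bound \<open>2 * e\<close> for the fourth moment of a ground state.\<close>
    define \<eta> where "\<eta> = sqrt (e / (100 * \<rho>))"
    have \<eta>: "0 < \<eta>" "100 * \<eta>\<^sup>2 * \<rho> = e" using e \<rho> by (simp_all add: \<eta>_def)
    have "ennreal \<eta> \<le> Lp_norm \<infinity> (u t)" for t
    proof (rule ccontr)
      assume "\<not> ennreal \<eta> \<le> Lp_norm \<infinity> (u t)"
      then have bd: "AE x in lborel. norm (u t x) \<le> \<eta>"
        using \<eta> by (intro AE_le_of_Lp_norm_top_le) auto
      have "u t \<in> H1" using sol by (auto simp: NLS_solution_from_def NLS_solution_def)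
      then have ut: "u t \<in> L2" by (simp add: H1_def)
      have "dist_ground_states \<rho> (u t) \<le> (SUP t. dist_ground_states \<rho> (u t))"
        by (rule SUP_upper) simp
      also have "\<dots> \<le> ennreal \<epsilon>" using \<epsilon> u0 sol unfolding stability_delta_def by blast
      \<comment> \<open>A ground state that almost attains the infimum is enough, hence the factor 2 and \<open>c / 2\<close> as the bound for \<open>\<epsilon>\<close>.\<close>
      also have "\<dots> < ennreal (2 * \<epsilon>)" using \<epsilon> by (simp add: ennreal_less_iff)
      finally obtain \<phi> where \<phi>: "\<phi> \<in> ground_states \<rho>"
        and near\<phi>: "ennreal (H1_norm (\<lambda>x. u t x - \<phi> x)) < ennreal (2 * \<epsilon>)"
        unfolding dist_ground_states_def INF_less_iff by blast
      have H: "H1_norm (\<lambda>x. u t x - \<phi> x) < 2 * \<epsilon>"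
        using near\<phi> by (subst (asm) ennreal_less_iff) (auto simp: H1_norm_def)
      have "enn2real (moment 2 (\<lambda>x. u t x - \<phi> x)) \<le> (H1_norm (\<lambda>x. u t x - \<phi> x))\<^sup>2"
        by (simp add: H1_norm_def Lp_norm_power_moment)
      also have "\<dots> \<le> c\<^sup>2"
        using H \<epsilon> by (intro power_mono) (auto simp: H1_norm_def)
      finally have "enn2real (moment 2 (\<lambda>x. u t x - \<phi> x)) \<le> c\<^sup>2" .
      then have "enn2real (moment 4 \<phi>) \<le> 136 * \<eta>\<^sup>2 * mass \<phi>"
        using near[of \<phi> "u t" \<eta>] bd ut \<eta>(1) ground_state_moment4[OF \<phi>] E by simp
      then show False using ground_state_moment4[OF \<phi>] \<eta>(2) e by (simp add: e_def)
    qed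
    then have "ennreal \<eta> \<le> (INF t. Lp_norm \<infinity> (u t))" by (intro INF_greatest)
    moreover have "0 < ennreal \<eta>" using \<eta> by simp
    ultimately show "0 < (INF t. Lp_norm \<infinity> (u t))" by (rule less_le_trans[rotated])
  qed
qed

end
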